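(* Let $p>1$, let $n$ be a positive integer and let $f$ be an eigenfunction corresponding to the variational eigenvalue $\lambda_k$ ($1\le k\le n$) of the graph $p$-Laplacian $\Delta_p$ on the unweighted path graph $P_n$. Then the number of zero entries of $f$ is at most $k-1$, and $f$ induces exactly $k$ weak nodal domains and exactly $k$ strong nodal domains.
   Context: $P_n$ is the path graph with vertex set $V=\{1,\dots,n\}$, with an edge between $i$ and $i+1$ for $1\le i\le n-1$ and no other edges. All vertex weights are $\mu(i)=1$ and all edge weights are $1$, i.e. $w(ij)=1$ if $|i-j|=1$ and $w(ij)=0$ otherwise. Eigenpairs: put $\Phi_p(x)=|x|^{p-2}x$ (with $\Phi_p(0)=0$) and $(\Delta_p f)(u)=\sum_{v\in V}w(uv)\Phi_p(f(u)-f(v))$ for $f:V\to\mathbb{R}$. A nonzero $f:V\to\mathbb{R}$ is an eigenfunction of $\Delta_p$ with eigenvalue $\lambda$ if $(\Delta_p f)(u)=\lambda\,\Phi_p(f(u))$ for all $u\in V$. Variational eigenvalues: for nonzero $f:V\to\mathbb R$ let $\mathcal{R}_p(f)=\frac12\,\frac{\sum_{u,v\in V}w(uv)|f(u)-f(v)|^p}{\sum_{u\in V}|f(u)|^p}$, and let $\mathcal{S}_p=\{g:V\to\mathbb{R}:\sum_{u}|g(u)|^p=1\}$. For a closed symmetric set $A=-A\subseteq\mathcal{S}_p$ the Krasnoselskii genus $\gamma(A)$ is $0$ if $A=\emptyset$, and otherwise the smallest integer $m$ for which there is a continuous odd map $h:A\to\mathbb{R}^m\setminus\{0\}$ ($\infty$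 if there is none). Let $\mathcal{F}_k(\mathcal{S}_p)=\{A\subseteq\mathcal{S}_p: A=-A,\ A\text{ closed},\ \gamma(A)\ge k\}$. The variational eigenvalues are $\lambda_k=\min_{A\in\mathcal{F}_k(\mathcal{S}_p)}\max_{f\in A}\mathcal{R}_p(f)$, $k=1,\dots,n$. Nodal domains: a subset $A\subseteq V$ is a strong (respectively weak) nodal domain induced by $f$ if the subgraph induced by $A$ is a maximal connected component of (the subgraph induced by) either $\{u:f(u)>0\}$ or $\{u:f(u)<0\}$ (respectively either $\{u:f(u)\ge 0\}$ or $\{u:f(u)\le 0\}$). *)

theory Defs
  imports "HOL-Analysis.Analysis" "HOL-Library.Extended_Nat"
begin

section \<open>The path graph\<close>

definition path_verts :: "nat \<Rightarrow> nat set" where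
  "path_verts n = {1..n}"

definition path_edges :: "nat \<Rightarrow> (nat \<times> nat) set" where
  "path_edges n = {(i, j). i \<in> path_verts n \<and> j \<in> path_verts n \<and> (j = i + 1 \<or> i = j + 1)}"

definition path_weight :: "nat \<Rightarrow> nat \<Rightarrow> nat \<Rightarrow> real" where
  "path_weight n i j = (if (i, j) \<in> path_edges n then 1 else 0)"


section \<open>The graph p-Laplacian and its eigenpairs\<close>

definition p_power :: "real \<Rightarrow> real \<Rightarrow> real" where
  "p_power p x = \<bar>x\<bar> powr (p - 2) * x"

definition p_laplacian ::
    "'a set \<Rightarrow> ('a \<Rightarrow> 'a \<Rightarrow> real) \<Rightarrow> real \<Rightarrow> ('a \<Rightarrow> real) \<Rightarrow> 'a \<Rightarrow> real" where
  "p_laplacian V w p f u = (\<Sum>v\<in>V. w u v * p_power p (f u - f v))"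

text \<open>
  A real function on \<open>V\<close> is given by a function on the whole vertex type. Here, as in the
  nodal domains below, its values outside \<open>V\<close> play no role.
\<close>

definition p_eigenfunction ::
    "'a set \<Rightarrow> ('a \<Rightarrow> 'a \<Rightarrow> real) \<Rightarrow> real \<Rightarrow> real \<Rightarrow> ('a \<Rightarrow> real) \<Rightarrow> bool" where
  "p_eigenfunction V w p ev f \<longleftrightarrow>
     (\<exists>u\<in>V. f u \<noteq> 0) \<and> (\<forall>u\<in>V. p_laplacian V w p f u = ev * p_power p (f u))"


section \<open>Variational eigenvalues\<close>

definition p_rayleigh ::
    "'a set \<Rightarrow> ('a \<Rightarrow> 'a \<Rightarrow> real) \<Rightarrow> real \<Rightarrow> ('a \<Rightarrow> real) \<Rightarrow> real" where
  "p_rayleigh V w p f =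
     1 / 2 * ((\<Sum>u\<in>V. \<Sum>v\<in>V. w u v * \<bar>f u - f v\<bar> powr p) / (\<Sum>u\<in>V. \<bar>f u\<bar> powr p))"

text \<open>
  For the topological notions, the space of real functions on \<open>V\<close> is the closed subspace of
  \<^typ>\<open>'a \<Rightarrow> real\<close> (with the product topology) of the functions vanishing outside \<open>V\<close>;
  for finite \<open>V\<close> it carries the Euclidean topology. The library's \<^term>\<open>Euclidean_space m\<close>
  encodes real m-space in the same way.
\<close>

definition p_sphere :: "'a set \<Rightarrow> real \<Rightarrow> ('a \<Rightarrow> real) set" where
  "p_sphere V p = {g. (\<forall>v. v \<notin> V \<longrightarrow> g v = 0) \<and> (\<Sum>v\<in>V. \<bar>g v\<bar> powr p) = 1}"

definition symmetric_set :: "('a \<Rightarrow> real) set \<Rightarrow> bool" where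
  "symmetric_set A \<longleftrightarrow> (\<lambda>g v. - g v) ` A = A"

definition odd_map_to_punctured ::
    "('a \<Rightarrow> real) set \<Rightarrow> nat \<Rightarrow> (('a \<Rightarrow> real) \<Rightarrow> (nat \<Rightarrow> real)) \<Rightarrow> bool" where
  "odd_map_to_punctured A m h \<longleftrightarrow>
     continuous_map (top_of_set A) (Euclidean_space m) h \<and>
     (\<forall>g\<in>A. h g \<noteq> (\<lambda>i. 0)) \<and>
     (\<forall>g\<in>A. h (\<lambda>v. - g v) = (\<lambda>i. - h g i))"

text \<open>The infimum of the empty set in \<^typ>\<open>enat\<close> is \<open>\<infinity>\<close>; any other infimum is attained.\<close>

definition genus :: "('a \<Rightarrow> real) set \<Rightarrow> enat" where
  "genus A = (if A = {} then 0 else Inf {enat m | m. \<exists>h. odd_map_to_punctured A m h})"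

definition genus_family :: "'a set \<Rightarrow> real \<Rightarrow> nat \<Rightarrow> ('a \<Rightarrow> real) set set" where
  "genus_family V p k =
     {A. A \<subseteq> p_sphere V p \<and> symmetric_set A \<and> closed A \<and> enat k \<le> genus A}"

text \<open>
  For finite \<open>V\<close>, nonnegative \<open>w\<close>, \<open>p > 1\<close> and \<open>1 \<le> k \<le> card V\<close>, the family is nonempty and
  all its members are nonempty and compact; the supremum is then a maximum and the infimum
  a minimum.
\<close>

definition variational_eigenvalue ::
    "'a set \<Rightarrow> ('a \<Rightarrow> 'a \<Rightarrow> real) \<Rightarrow> real \<Rightarrow> nat \<Rightarrow> real" where
  "variational_eigenvalue V w p k = (INF A \<in> genus_family V p k. SUP g \<in> A. p_rayleigh V w p g)"


section \<open>Nodal domains\<close>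

text \<open>The edge relation \<open>E\<close> is symmetric; connectedness is that of the induced subgraph.\<close>

definition connected_in :: "('a \<times> 'a) set \<Rightarrow> 'a set \<Rightarrow> bool" where
  "connected_in E A \<longleftrightarrow> A \<noteq> {} \<and> (\<forall>u\<in>A. \<forall>v\<in>A. (u, v) \<in> (E \<inter> A \<times> A)\<^sup>*)"

definition graph_component :: "('a \<times> 'a) set \<Rightarrow> 'a set \<Rightarrow> 'a set \<Rightarrow> bool" where
  "graph_component E S A \<longleftrightarrow>
     A \<subseteq> S \<and> connected_in E A \<and> (\<forall>B. A \<subseteq> B \<and> B \<subseteq> S \<and> connected_in E B \<longrightarrow> B = A)"

definition strong_nodal_domain ::
    "'a set \<Rightarrow> ('a \<times> 'a) set \<Rightarrow> ('a \<Rightarrow> real) \<Rightarrow> 'a set \<Rightarrow> bool" where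
  "strong_nodal_domain V E f A \<longleftrightarrow>
     graph_component E {u \<in> V. f u > 0} A \<or> graph_component E {u \<in> V. f u < 0} A"

definition weak_nodal_domain ::
    "'a set \<Rightarrow> ('a \<times> 'a) set \<Rightarrow> ('a \<Rightarrow> real) \<Rightarrow> 'a set \<Rightarrow> bool" where
  "weak_nodal_domain V E f A \<longleftrightarrow>
     graph_component E {u \<in> V. f u \<ge> 0} A \<or> graph_component E {u \<in> V. f u \<le> 0} A"

end

theory Submission
  imports Defs "HOL-Homology.Invariance_of_Domain"
begin

text \<open>
  On a path the eigenvalue equation is a three-term recurrence: it determines \<open>f\<close> from the
  eigenvalue \<open>\<lambda>\<close> and the value \<open>f 1\<close>. Two adjacent zeros would propagate to \<open>f 1\<close>, and at a
  single zero the recurrence makes the two neighbours opposite. So \<open>f\<close> oscillates: its zeros are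
  interior, isolated and accompanied by a sign change. Cutting the path at each sign change gives
  blocks \<open>0, \<dots>, s\<close>; a strong nodal domain is a block without its zeros, a weak one a block
  together with the zero that may follow it, and every zero opens a block other than the first.
  All three claims therefore reduce to \<open>s + 1 = k\<close>.

  For this, \<open>\<lambda> = \<lambda>\<^sub>k\<close> is compared with solutions \<open>F\<close> of the recurrence for parameters \<open>\<mu>\<close> close to
  \<open>\<lambda>\<close>, started at the same value. They depend continuously on \<open>\<mu>\<close>, so the signs at the nonzero
  entries of \<open>f\<close> persist and the number of blocks does not change (\<open>block_perturb\<close>). Such an \<open>F\<close>
  need not satisfy the eigenvalue equation at the last vertex, which is harmless for functions
  that vanish there. The gain is strictness: an inequality with \<open>\<mu> \<noteq> \<lambda>\<close> contradicts
  \<open>\<lambda> = \<lambda>\<^sub>k\<close>. For a function \<open>g u = c u * F u\<close> vanishing at the last vertex, summation by parts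
  (\<open>p_solution_energy\<close>) turns \<open>\<mu> \<Sum>\<bar>g\<bar>\<^sup>p\<close> into a sum over the edges, and convexity of
  \<open>\<bar>x\<bar>\<^sup>p\<close> compares that sum with the energy of \<open>g\<close> edge by edge: one way on edges inside a
  block (a discrete Picone inequality), the other way on edges between blocks.

  If \<open>s + 1 < k\<close>, take \<open>\<mu> > \<lambda>\<close>. The conditions that \<open>g\<close> be proportional to \<open>F\<close> across each of the
  \<open>s\<close> cuts and vanish at the last vertex are \<open>s + 1\<close> odd functionals; a set of genus at least \<open>k\<close>
  contains a common zero \<open>g\<close> of them, and the energy of \<open>g\<close> is at least \<open>\<mu>\<close>. So
  \<open>\<lambda>\<^sub>k \<ge> \<mu> > \<lambda>\<close>. If \<open>k \<le> s\<close>, take \<open>\<mu> < \<lambda>\<close>. The functions that are multiples of \<open>F\<close> on each of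
  the first \<open>k\<close> blocks and vanish on the others have energy at most \<open>\<mu>\<close> on the unit sphere, and
  they form a set of genus at least \<open>k\<close>. So \<open>\<lambda>\<^sub>k \<le> \<mu> < \<lambda>\<close>.

  That the sphere of a \<open>k\<close>-dimensional space has genus at least \<open>k\<close> is the Borsuk-Ulam theorem. It
  follows from the fact that an odd self-map of a sphere has odd degree, which is proved by
  induction on the dimension: after a homotopy through nonvanishing maps the equator is mapped into
  the equator, and then the degrees of the map and of its restriction have the same parity.
\<close>

section \<open>Spheres and degrees of normalised maps\<close>

lemma nsphere_eq_top_of_set: "nsphere d = top_of_set (topspace (nsphere d))"
  by (simp add: nsphere euclidean_product_topology)

lemma mem_nsphere: "x \<in> topspace (nsphere d) \<longleftrightarrow> (\<Sum>i\<le>d. (x i)\<^sup>2) = 1 \<and> (\<forall>i>d. x i = 0)"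
  by (simp add: nsphere)

lemma nsphere_coord_le_1:
  assumes "x \<in> topspace (nsphere d)"
  shows "\<bar>x i\<bar> \<le> 1"
proof (cases "i \<le> d")
  case True
  then have "(x i)\<^sup>2 \<le> (\<Sum>i\<le>d. (x i)\<^sup>2)" by (intro member_le_sum) auto
  also have "\<dots> = 1" using assms by (simp add: mem_nsphere)
  finally show ?thesis by (simp add: abs_square_le_1)
qed (use assms in \<open>auto simp: mem_nsphere\<close>)

lemma nsphere_large_coord:
  assumes "x \<in> topspace (nsphere d)"
  shows "\<exists>i\<le>d. 1 / (real d + 1) \<le> \<bar>x i\<bar>"
proof (rule ccontr)
  assume "\<not> ?thesis"
  then have *: "\<bar>x i\<bar> < 1 / (real d + 1)" if "i \<le> d" for i using that by force
  have "(x i)\<^sup>2 < 1 / (real d + 1)" if "i \<le> d" for i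
  proof -
    have "(x i)\<^sup>2 = \<bar>x i\<bar> * \<bar>x i\<bar>" by (simp add: power2_eq_square)
    also have "\<dots> \<le> \<bar>x i\<bar> * 1"
      using nsphere_coord_le_1[OF assms] by (intro mult_left_mono) auto
    finally show ?thesis using *[OF that] by simp
  qed
  then have "(\<Sum>i\<le>d. (x i)\<^sup>2) < (\<Sum>i\<le>d. 1 / (real d + 1))"
    by (intro sum_strict_mono) auto
  then show False using assms by (simp add: mem_nsphere)
qed

lemma uminus_mem_nsphere:
  assumes "x \<in> topspace (nsphere d)"
  shows "(\<lambda>i. - x i) \<in> topspace (nsphere d)"
  using assms by (simp add: mem_nsphere)

lemma compact_nsphere: "compact (topspace (nsphere d))"
proof -
  let ?B = "PiE UNIV (\<lambda>_::nat. {-1..1::real})"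
  have "compact ?B"
    using compactin_PiE[of "\<lambda>_. euclideanreal" UNIV "\<lambda>_. {-1..1}"]
    by (simp add: euclidean_product_topology)
  moreover have "closed (topspace (nsphere d))"
  proof -
    have "topspace (nsphere d) = {x. (\<Sum>i\<le>d. (x i)\<^sup>2) = 1} \<inter> (\<Inter>i\<in>{d<..}. {x. x i = 0})"
      by (auto simp: mem_nsphere)
    moreover have "closed \<dots>"
      by (intro closed_Int closed_INT ballI closed_Collect_eq continuous_intros continuous_on_product_coordinates)
    ultimately show ?thesis by simp
  qed
  moreover have "topspace (nsphere d) \<subseteq> ?B"
    using nsphere_coord_le_1 by (force simp: abs_le_iff)
  ultimately show ?thesis
    by (metis compact_Int_closed inf.absorb_iff2)
qed

lemma continuous_map_nsphere_iff:
  "continuous_map (nsphere d) (nsphere e) f \<longleftrightarrow>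
   (\<forall>i. continuous_on (topspace (nsphere d)) (\<lambda>x. f x i)) \<and>
   f \<in> topspace (nsphere d) \<rightarrow> topspace (nsphere e)"
proof -
  have "continuous_map (nsphere d) (nsphere e) f \<longleftrightarrow>
     continuous_map (top_of_set (topspace (nsphere d))) (top_of_set (topspace (nsphere e))) f"
    using nsphere_eq_top_of_set by metis
  also have "\<dots> \<longleftrightarrow> continuous_on (topspace (nsphere d)) f \<and>
   f \<in> topspace (nsphere d) \<rightarrow> topspace (nsphere e)"
    by (simp add: continuous_map_in_subtopology image_subset_iff_funcset)
  also have "continuous_on (topspace (nsphere d)) f \<longleftrightarrow> (\<forall>i. continuous_on (topspace (nsphere d)) (\<lambda>x. f x i))"
    by (blast intro: continuous_on_coordinatewise_then_product continuous_on_product_then_coordinatewise)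
  finally show ?thesis .
qed

definition normalise :: "nat \<Rightarrow> (nat \<Rightarrow> real) \<Rightarrow> nat \<Rightarrow> real" where
  "normalise d v = (\<lambda>i. if i \<le> d then v i / sqrt (\<Sum>j\<le>d. (v j)\<^sup>2) else 0)"

lemma normalise_mem_nsphere:
  assumes "\<exists>i\<le>d. v i \<noteq> 0"
  shows "normalise d v \<in> topspace (nsphere d)"
proof -
  have "(\<Sum>j\<le>d. (v j)\<^sup>2) > 0"
    using assms by (auto intro!: sum_pos2)
  then have "(\<Sum>i\<le>d. (v i / sqrt (\<Sum>j\<le>d. (v j)\<^sup>2))\<^sup>2) = 1"
    by (simp add: power_divide flip: sum_divide_distrib)
  then show ?thesis by (simp add: mem_nsphere normalise_def)
qed

lemma normalise_ident:
  assumes "v \<in> topspace (nsphere d)"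
  shows "normalise d v = v"
  using assms by (auto simp: mem_nsphere normalise_def)

lemma continuous_on_normalise:
  assumes "\<And>i. i \<le> d \<Longrightarrow> continuous_on S (\<lambda>x. H x i)" and "\<And>x. x \<in> S \<Longrightarrow> \<exists>i\<le>d. H x i \<noteq> 0"
  shows "continuous_on S (\<lambda>x. normalise d (H x) i)"
proof (cases "i \<le> d")
  case True
  have "sqrt (\<Sum>j\<le>d. (H x j)\<^sup>2) \<noteq> 0" if "x \<in> S" for x
  proof -
    have "(\<Sum>j\<le>d. (H x j)\<^sup>2) > 0" using assms(2)[OF that] by (auto intro!: sum_pos2)
    then show ?thesis by simp
  qed
  then show ?thesis
    using True unfolding normalise_def by (auto intro!: continuous_intros assms)
qed (simp add: normalise_def)

text \<open>
  Every homotopy used below is a formula in the coordinates that stays away from the origin; this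
  is the bridge from such formulas to homotopies of self-maps of the sphere.
\<close>

lemma Brouwer_degree2_normalise_homotopic:
  fixes H :: "real \<Rightarrow> (nat \<Rightarrow> real) \<Rightarrow> nat \<Rightarrow> real"
  assumes "\<And>i. i \<le> d \<Longrightarrow> continuous_on ({0..1} \<times> topspace (nsphere d)) (\<lambda>(t, x). H t x i)"
    and "\<And>t x. t \<in> {0..1} \<Longrightarrow> x \<in> topspace (nsphere d) \<Longrightarrow> \<exists>i\<le>d. H t x i \<noteq> 0"
  shows "Brouwer_degree2 d (\<lambda>x. normalise d (H 0 x)) = Brouwer_degree2 d (\<lambda>x. normalise d (H 1 x))"
proof (rule Brouwer_degree2_homotopic)
  let ?S = "topspace (nsphere d)"
  let ?h = "\<lambda>(t, x). normalise d (H t x)"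
  have "prod_topology (top_of_set {0..1}) (nsphere d) = top_of_set ({0..1::real} \<times> ?S)"
    by (subst nsphere_eq_top_of_set) simp
  moreover have "continuous_on ({0..1} \<times> ?S) ?h"
  proof (rule continuous_on_coordinatewise_then_product)
    fix i
    have "continuous_on ({0..1} \<times> ?S) (\<lambda>z. normalise d ((\<lambda>(t, x). H t x) z) i)"
      using assms by (intro continuous_on_normalise) (auto simp: case_prod_beta)
    then show "continuous_on ({0..1} \<times> ?S) (\<lambda>z. ?h z i)" by (simp add: case_prod_beta)
  qed
  moreover have "?h \<in> {0..1} \<times> ?S \<rightarrow> ?S"
    using assms(2) by (auto intro: normalise_mem_nsphere)
  ultimately have "continuous_map (prod_topology (top_of_set {0..1}) (nsphere d)) (nsphere d) ?h"
    by (subst (2) nsphere_eq_top_of_set) (simp add: continuous_map_in_subtopology image_subset_iff_funcset)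
  then show "homotopic_with (\<lambda>x. True) (nsphere d) (nsphere d)
     (\<lambda>x. normalise d (H 0 x)) (\<lambda>x. normalise d (H 1 x))"
    by (subst homotopic_with) (auto intro!: exI[of _ ?h])
qed


section \<open>Odd Lipschitz approximation and general position\<close>

definition lipschitz_l1 ::
    "nat \<Rightarrow> real \<Rightarrow> (nat \<Rightarrow> real) set \<Rightarrow> ((nat \<Rightarrow> real) \<Rightarrow> real) \<Rightarrow> bool" where
  "lipschitz_l1 d L S f \<longleftrightarrow> (\<forall>x\<in>S. \<forall>y\<in>S. \<bar>f x - f y\<bar> \<le> L * (\<Sum>i\<le>d. \<bar>x i - y i\<bar>))"

lemma lipschitz_l1_imp_continuous_on:
  assumes "lipschitz_l1 d L S f"
  shows "continuous_on S f"
  unfolding continuous_on_def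
proof
  fix x assume x: "x \<in> S"
  have "continuous_on S (\<lambda>y. L * (\<Sum>i\<le>d. \<bar>y i - x i\<bar>))"
    by (intro continuous_intros continuous_on_product_coordinates continuous_on_subset[OF continuous_on_product_coordinates]) auto
  then have "((\<lambda>y. L * (\<Sum>i\<le>d. \<bar>y i - x i\<bar>)) \<longlongrightarrow> 0) (at x within S)"
    using x unfolding continuous_on_def by force
  moreover have "\<forall>\<^sub>F y in at x within S. norm (f y - f x) \<le> L * (\<Sum>i\<le>d. \<bar>y i - x i\<bar>)"
    using assms x by (auto simp: lipschitz_l1_def eventually_at_filter)
  ultimately have "((\<lambda>y. f y - f x) \<longlongrightarrow> 0) (at x within S)"
    using Lim_null_comparison by fast
  then show "(f \<longlongrightarrow> f x) (at x within S)" by (simp add: LIM_zero_iff)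
qed

lemma lipschitz_l1_mult:
  assumes f: "lipschitz_l1 d L S f" and g: "lipschitz_l1 d K S g" and "compact S"
  shows "\<exists>M. lipschitz_l1 d M S (\<lambda>x. f x * g x)"
proof -
  have bdd: "\<exists>B\<ge>0. \<forall>x\<in>S. \<bar>h x\<bar> \<le> B" if "lipschitz_l1 d M S h" for h :: "(nat \<Rightarrow> real) \<Rightarrow> real" and M
  proof -
    have "bounded (h ` S)"
      by (intro compact_imp_bounded compact_continuous_image lipschitz_l1_imp_continuous_on[OF that] assms)
    then obtain B where "B > 0" "\<forall>x\<in>S. \<bar>h x\<bar> \<le> B" by (auto simp: bounded_pos)
    then show ?thesis by (intro exI[of _ B]) auto
  qed
  obtain B where B: "B \<ge> 0" "\<And>x. x \<in> S \<Longrightarrow> \<bar>f x\<bar> \<le> B" using bdd[OF f] by blast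
  obtain C where C: "C \<ge> 0" "\<And>x. x \<in> S \<Longrightarrow> \<bar>g x\<bar> \<le> C" using bdd[OF g] by blast
  have "\<bar>f x * g x - f y * g y\<bar> \<le> (B * K + C * L) * (\<Sum>i\<le>d. \<bar>x i - y i\<bar>)" if "x \<in> S" "y \<in> S" for x y
  proof -
    have "\<bar>f x * g x - f y * g y\<bar> = \<bar>f x * (g x - g y) + g y * (f x - f y)\<bar>" by (simp add: algebra_simps)
    also have "\<dots> \<le> \<bar>f x\<bar> * \<bar>g x - g y\<bar> + \<bar>g y\<bar> * \<bar>f x - f y\<bar>"
      by (metis abs_mult abs_triangle_ineq)
    also have "\<dots> \<le> B * (K * (\<Sum>i\<le>d. \<bar>x i - y i\<bar>)) + C * (L * (\<Sum>i\<le>d. \<bar>x i - y i\<bar>))"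
      using that f g B C unfolding lipschitz_l1_def by (intro add_mono mult_mono) auto
    finally show ?thesis by (simp add: algebra_simps)
  qed
  then show ?thesis unfolding lipschitz_l1_def by blast
qed

text \<open>
  The Lipschitz functions on the sphere form an algebra that separates points, so Stone-Weierstrass
  applies; taking the odd part of the approximation does not increase the error.
\<close>

lemma lipschitz_odd_approximation:
  assumes f: "continuous_on (topspace (nsphere d)) f"
    and odd: "\<And>x. x \<in> topspace (nsphere d) \<Longrightarrow> f (\<lambda>i. - x i) = - f x" and "e > 0"
  obtains L g where "lipschitz_l1 d L (topspace (nsphere d)) g"
    and "\<And>x. x \<in> topspace (nsphere d) \<Longrightarrow> \<bar>f x - g x\<bar> < e"
    and "\<And>x. g (\<lambda>i. - x i) = - g x"
proof -
  let ?S = "topspace (nsphere d)"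
  have "\<exists>g. (\<exists>L. lipschitz_l1 d L ?S g) \<and> (\<forall>x\<in>?S. \<bar>f x - g x\<bar> < e)"
  proof (rule Stone_Weierstrass_HOL[where P = "\<lambda>f. \<exists>L. lipschitz_l1 d L ?S f"])
    show "\<exists>L. lipschitz_l1 d L ?S (\<lambda>x. c)" for c
      by (auto simp: lipschitz_l1_def intro!: exI[of _ 0])
    show "\<exists>L. lipschitz_l1 d L ?S (\<lambda>x. f x + g x)"
      if fg: "(\<exists>L. lipschitz_l1 d L ?S f) \<and> (\<exists>L. lipschitz_l1 d L ?S g)" for f g
    proof -
      obtain L K where L: "lipschitz_l1 d L ?S f" and K: "lipschitz_l1 d K ?S g" using fg by blast
      have "\<bar>(f x + g x) - (f y + g y)\<bar> \<le> (L + K) * (\<Sum>i\<le>d. \<bar>x i - y i\<bar>)" if "x \<in> ?S" "y \<in> ?S" for x y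
      proof -
        have "\<bar>f x - f y\<bar> \<le> L * (\<Sum>i\<le>d. \<bar>x i - y i\<bar>)" "\<bar>g x - g y\<bar> \<le> K * (\<Sum>i\<le>d. \<bar>x i - y i\<bar>)"
          using L K that by (auto simp: lipschitz_l1_def)
        then show ?thesis unfolding distrib_right by linarith
      qed
      then show ?thesis unfolding lipschitz_l1_def by blast
    qed
    show "\<exists>g. (\<exists>L. lipschitz_l1 d L ?S g) \<and> g x \<noteq> g y" if xy: "x \<in> ?S \<and> y \<in> ?S \<and> x \<noteq> y" for x y
    proof -
      obtain i where "x i \<noteq> y i" using xy by blast
      with xy have "i \<le> d" by (metis mem_nsphere not_le)
      have "lipschitz_l1 d 1 ?S (\<lambda>x. x i)"
        unfolding lipschitz_l1_def using \<open>i \<le> d\<close>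
        by (auto intro: member_le_sum[of i "{..d}" "\<lambda>i. \<bar>x i - y i\<bar>" for x y :: "nat \<Rightarrow> real"])
      then show ?thesis using \<open>x i \<noteq> y i\<close> by blast
    qed
  qed (use f compact_nsphere \<open>e > 0\<close> lipschitz_l1_imp_continuous_on lipschitz_l1_mult in blast)+
  then obtain g L where L: "lipschitz_l1 d L ?S g" and g: "\<And>x. x \<in> ?S \<Longrightarrow> \<bar>f x - g x\<bar> < e" by blast
  let ?g = "\<lambda>x. (g x - g (\<lambda>i. - x i)) / 2"
  show thesis
  proof
    show "lipschitz_l1 d L ?S ?g"
      unfolding lipschitz_l1_def
    proof (intro ballI)
      fix x y assume xy: "x \<in> ?S" "y \<in> ?S"
      have "\<bar>g x - g y\<bar> \<le> L * (\<Sum>i\<le>d. \<bar>x i - y i\<bar>)" using L xy by (simp add: lipschitz_l1_def)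
      moreover have "\<bar>g (\<lambda>i. - x i) - g (\<lambda>i. - y i)\<bar> \<le> L * (\<Sum>i\<le>d. \<bar>x i - y i\<bar>)"
      proof -
        have "(\<Sum>i\<le>d. \<bar>- x i - - y i\<bar>) = (\<Sum>i\<le>d. \<bar>x i - y i\<bar>)"
          by (intro sum.cong) auto
        then show ?thesis
          using L uminus_mem_nsphere[OF xy(1)] uminus_mem_nsphere[OF xy(2)] unfolding lipschitz_l1_def by metis
      qed
      moreover have "\<bar>(a - b) / 2 - (c - e) / 2\<bar> \<le> K" if "\<bar>a - c\<bar> \<le> K" "\<bar>b - e\<bar> \<le> K" for a b c e K :: real
        using that unfolding abs_le_iff by (simp add: field_simps)
      ultimately show "\<bar>?g x - ?g y\<bar> \<le> L * (\<Sum>i\<le>d. \<bar>x i - y i\<bar>)"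
        by blast
    qed
    show "\<bar>f x - ?g x\<bar> < e" if "x \<in> ?S" for x
      using g[OF that] g[OF uminus_mem_nsphere[OF that]] odd[OF that] by (simp add: abs_if field_simps split: if_splits)
    show "?g (\<lambda>i. - x i) = - ?g x" for x by (simp add: minus_divide_left)
  qed
qed

text \<open>
  Near a point whose \<open>j\<close>-th coordinate is not small, the sphere is a Lipschitz graph over the
  remaining coordinates: \<open>(x j - y j) * (x j + y j)\<close> is controlled by the other coordinates. So \<open>d\<close>
  parameters describe a \<open>d\<close>-dimensional sphere at any given scale.
\<close>

lemma nsphere_l1_le_from_cell:
  assumes x: "x \<in> topspace (nsphere d)" and y: "y \<in> topspace (nsphere d)" and "j \<le> d"
    and xj: "1 / (real d + 1) \<le> \<bar>x j\<bar>" and yj: "1 / (real d + 1) \<le> \<bar>y j\<bar>" and sgn: "x j > 0 \<longleftrightarrow> y j > 0"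
    and close: "\<And>i. i \<le> d \<Longrightarrow> i \<noteq> j \<Longrightarrow> \<bar>x i - y i\<bar> \<le> \<epsilon>" and "\<epsilon> \<ge> 0"
  shows "(\<Sum>i\<le>d. \<bar>x i - y i\<bar>) \<le> (real d + 1)\<^sup>2 * \<epsilon>"
proof -
  let ?I = "{..d} - {j}"
  have card: "card ?I = d" using \<open>j \<le> d\<close> by simp
  have rest: "(\<Sum>i\<in>?I. \<bar>x i - y i\<bar>) \<le> real d * \<epsilon>"
    using sum_bounded_above[of ?I "\<lambda>i. \<bar>x i - y i\<bar>" \<epsilon>] close card by auto
  have split: "(\<Sum>i\<le>d. h i) = h j + (\<Sum>i\<in>?I. h i)" for h :: "nat \<Rightarrow> real"
    using \<open>j \<le> d\<close> by (simp add: sum.remove)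
  have "(x j)\<^sup>2 - (y j)\<^sup>2 = (\<Sum>i\<in>?I. (y i)\<^sup>2 - (x i)\<^sup>2)"
    using x y split[of "\<lambda>i. (x i)\<^sup>2"] split[of "\<lambda>i. (y i)\<^sup>2"] by (simp add: mem_nsphere sum_subtractf)
  also have "\<bar>\<dots>\<bar> \<le> (\<Sum>i\<in>?I. 2 * \<bar>x i - y i\<bar>)"
  proof (rule order_trans[OF sum_abs], rule sum_mono)
    fix i
    have "\<bar>(y i)\<^sup>2 - (x i)\<^sup>2\<bar> = \<bar>y i + x i\<bar> * \<bar>x i - y i\<bar>"
      by (simp add: power2_eq_square abs_minus_commute flip: abs_mult) (simp add: algebra_simps abs_minus_commute)
    also have "\<bar>y i + x i\<bar> \<le> 2" using nsphere_coord_le_1[OF x, of i] nsphere_coord_le_1[OF y, of i] by linarith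
    finally show "\<bar>(y i)\<^sup>2 - (x i)\<^sup>2\<bar> \<le> 2 * \<bar>x i - y i\<bar>" by (simp add: mult_right_mono)
  qed
  also have "\<dots> \<le> 2 * (real d * \<epsilon>)" using rest by (simp flip: sum_distrib_left)
  finally have sq: "\<bar>(x j)\<^sup>2 - (y j)\<^sup>2\<bar> \<le> 2 * (real d * \<epsilon>)" .
  have "2 / (real d + 1) \<le> \<bar>x j + y j\<bar>"
    using xj yj sgn by (smt (verit) add_divide_distrib)
  then have "2 / (real d + 1) * \<bar>x j - y j\<bar> \<le> \<bar>x j + y j\<bar> * \<bar>x j - y j\<bar>" by (intro mult_right_mono) auto
  also have "\<dots> = \<bar>(x j)\<^sup>2 - (y j)\<^sup>2\<bar>" by (simp add: power2_eq_square algebra_simps flip: abs_mult)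
  finally have "2 / (real d + 1) * \<bar>x j - y j\<bar> \<le> 2 * (real d * \<epsilon>)" using sq by linarith
  then have "\<bar>x j - y j\<bar> \<le> (real d + 1) * (real d * \<epsilon>)" by (simp add: field_simps)
  with rest have "(\<Sum>i\<le>d. \<bar>x i - y i\<bar>) \<le> (real d + 1) * (real d * \<epsilon>) + real d * \<epsilon>" by (simp add: split)
  also have "\<dots> \<le> (real d + 1)\<^sup>2 * \<epsilon>" using \<open>\<epsilon> \<ge> 0\<close> by (simp add: power2_eq_square algebra_simps)
  finally show ?thesis .
qed



text \<open>
  General position by counting. If every direction \<open>(y, 1)\<close> were hit, then so would be the
  \<open>N ^ (d + 1)\<close> directions with \<open>y\<close> in a grid of mesh \<open>1 / N\<close>. But the sphere splits into
  \<open>O(N ^ d)\<close> cells of diameter small compared with \<open>1 / N\<close>, and by the Lipschitz bound one cell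
  cannot meet two grid directions.
\<close>

lemma lipschitz_image_misses_direction:
  fixes P :: "(nat \<Rightarrow> real) \<Rightarrow> nat \<Rightarrow> real"
  assumes lip: "\<And>i. i \<le> Suc d \<Longrightarrow> lipschitz_l1 d L (topspace (nsphere d)) (\<lambda>x. P x i)"
    and "c > 0" and big: "\<And>x. x \<in> topspace (nsphere d) \<Longrightarrow> \<exists>i\<le>Suc d. c \<le> \<bar>P x i\<bar>"
  obtains y where "\<And>x. x \<in> topspace (nsphere d) \<Longrightarrow> \<exists>i\<le>d. P x i \<noteq> y i * P x (Suc d)"
proof (rule ccontr)
  let ?S = "topspace (nsphere d)"
  assume "\<not> thesis"
  then have hit: "\<exists>x\<in>?S. \<forall>i\<le>d. P x i = y i * P x (Suc d)" for y using that by blast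
  obtain m :: nat where "max (2 * \<bar>L\<bar> * (real d + 1)\<^sup>2 / c) 1 < m"
    using reals_Archimedean2 by blast
  then have m: "m > 2 * \<bar>L\<bar> * (real d + 1)\<^sup>2 / c" "m \<ge> 1" by auto
  \<comment> \<open>the number of cells is at most \<open>2 * (d + 1) * (3 * m * N) ^ d\<close>, so this \<open>N\<close> leaves fewer cells than grid points\<close>
  define N where "N = 2 * (d + 1) * (3 * m) ^ d + 1"
  define M where "M = m * N"
  have "N \<ge> 1" "M \<ge> 1" using m by (auto simp: N_def M_def)
  define G where "G = PiE {..d} (\<lambda>_. {..<N})"
  define Y where "Y a = (\<lambda>i. real (a i) / real N)" for a :: "nat \<Rightarrow> nat"
  have "\<forall>a. \<exists>x. x \<in> ?S \<and> (\<forall>i\<le>d. P x i = Y a i * P x (Suc d))" using hit by blast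
  from choice[OF this] obtain X where
    X: "\<And>a. X a \<in> ?S" "\<And>a i. i \<le> d \<Longrightarrow> P (X a) i = Y a i * P (X a) (Suc d)" by blast
  have "\<forall>x\<in>?S. \<exists>j. j \<le> d \<and> 1 / (real d + 1) \<le> \<bar>x j\<bar>" using nsphere_large_coord by blast
  from bchoice[OF this] obtain J where J: "\<And>x. x \<in> ?S \<Longrightarrow> J x \<le> d \<and> 1 / (real d + 1) \<le> \<bar>x (J x)\<bar>"
    by blast
  \<comment> \<open>a cell records a large coordinate, its sign, and the other coordinates up to \<open>1 / M\<close>\<close>
  define C where "C x = (J x, \<lambda>i\<in>{..d}. if i = J x then (if x i > 0 then 1 else 0) else \<lfloor>real M * x i\<rfloor>)"
    for x :: "nat \<Rightarrow> real"
  define Z where "Z = (SIGMA j:{..d}. PiE {..d} (\<lambda>i. if i = j then {0, 1::int} else {- int M..int M}))"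
  have CZ: "C x \<in> Z" if "x \<in> ?S" for x
  proof -
    have "- int M \<le> \<lfloor>real M * x i\<rfloor> \<and> \<lfloor>real M * x i\<rfloor> \<le> int M" for i
    proof -
      have "\<bar>real M * x i\<bar> \<le> real M * 1"
        unfolding abs_mult using nsphere_coord_le_1[OF that, of i] by (intro mult_mono) auto
      then have "- real M \<le> real M * x i" "real M * x i \<le> real M" by auto
      then show ?thesis by (simp add: le_floor_iff floor_le_iff)
    qed
    then show ?thesis using J[OF that] by (auto simp: C_def Z_def)
  qed
  have finZ: "finite Z" unfolding Z_def by (intro finite_SigmaI finite_PiE) auto
  have "card Z = (\<Sum>j\<le>d. \<Prod>i\<le>d. card (if i = j then {0, 1::int} else {- int M..int M}))"
    unfolding Z_def by (subst card_SigmaI) (auto intro!: finite_PiE simp: card_PiE)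
  also have "\<dots> = (\<Sum>j\<le>d. 2 * (2 * M + 1) ^ d)"
  proof (rule sum.cong)
    fix j assume "j \<in> {..d}"
    then show "(\<Prod>i\<le>d. card (if i = j then {0, 1::int} else {- int M..int M})) = 2 * (2 * M + 1) ^ d"
      by (subst prod.remove[of _ j]) (auto simp: nat_add_distrib nat_mult_distrib cong: if_cong)
  qed simp
  also have "\<dots> = 2 * (d + 1) * (2 * M + 1) ^ d" by simp
  also have "\<dots> \<le> 2 * (d + 1) * (3 * M) ^ d"
    using \<open>M \<ge> 1\<close> by (intro mult_left_mono power_mono) auto
  also have "\<dots> = 2 * (d + 1) * (3 * m) ^ d * N ^ d" by (simp add: M_def power_mult_distrib algebra_simps)
  also have "\<dots> < N * N ^ d" using \<open>N \<ge> 1\<close> by (intro mult_strict_right_mono) (auto simp: N_def)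
  also have "\<dots> = card G" by (simp add: G_def card_PiE)
  finally have "card Z < card G" .
  moreover have "(C \<circ> X) ` G \<subseteq> Z" using CZ X by auto
  ultimately have "\<not> inj_on (C \<circ> X) G" using finZ card_inj_on_le[of "C \<circ> X" G Z] by linarith
  then obtain a b where ab: "a \<in> G" "b \<in> G" "a \<noteq> b" "C (X a) = C (X b)" by (auto simp: inj_on_def)
  let ?x = "X a" and ?y = "X b"
  have Jeq: "J ?x = J ?y" using ab by (simp add: C_def)
  have Ceq: "(if i = J ?x then (if ?x i > 0 then 1 else 0) else \<lfloor>real M * ?x i\<rfloor>) =
      (if i = J ?x then (if ?y i > 0 then 1 else 0) else \<lfloor>real M * ?y i\<rfloor>)" if "i \<le> d" for i
    using ab(4) that unfolding C_def Jeq by (auto simp: fun_eq_iff restrict_def dest!: spec[of _ i] split: if_splits)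
  have "(\<Sum>i\<le>d. \<bar>?x i - ?y i\<bar>) \<le> (real d + 1)\<^sup>2 * (1 / real M)"
  proof (rule nsphere_l1_le_from_cell[where j = "J ?x"])
    show "\<bar>?x i - ?y i\<bar> \<le> 1 / real M" if "i \<le> d" "i \<noteq> J ?x" for i
    proof -
      have "\<lfloor>real M * ?x i\<rfloor> = \<lfloor>real M * ?y i\<rfloor>" using Ceq[OF that(1)] that(2) by simp
      then have "\<bar>real M * ?x i - real M * ?y i\<bar> \<le> 1" by linarith
      then have "real M * \<bar>?x i - ?y i\<bar> \<le> 1" by (metis abs_mult abs_of_nat right_diff_distrib)
      then show ?thesis using \<open>M \<ge> 1\<close> by (simp add: field_simps)
    qed
    show "?x (J ?x) > 0 \<longleftrightarrow> ?y (J ?x) > 0" using Ceq[of "J ?x"] J[OF X(1)[of a]] by (auto split: if_splits)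
  qed (use X(1) J[OF X(1)[of a]] J[OF X(1)[of b]] Jeq in auto)
  then have near: "\<bar>P ?x i - P ?y i\<bar> \<le> \<bar>L\<bar> * ((real d + 1)\<^sup>2 / real M)" if "i \<le> Suc d" for i
  proof -
    assume near: "(\<Sum>i\<le>d. \<bar>?x i - ?y i\<bar>) \<le> (real d + 1)\<^sup>2 * (1 / real M)"
    have "\<bar>P ?x i - P ?y i\<bar> \<le> L * (\<Sum>i\<le>d. \<bar>?x i - ?y i\<bar>)"
      using lip[OF that] X by (auto simp: lipschitz_l1_def)
    also have "\<dots> \<le> \<bar>L\<bar> * (\<Sum>i\<le>d. \<bar>?x i - ?y i\<bar>)"
      by (intro mult_right_mono sum_nonneg) auto
    also have "\<dots> \<le> \<bar>L\<bar> * ((real d + 1)\<^sup>2 / real M)" using near by (intro mult_left_mono) auto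
    finally show ?thesis .
  qed
  have Ybd: "0 \<le> Y e i \<and> Y e i \<le> 1" if "e \<in> G" "i \<le> d" for e i
    using that \<open>N \<ge> 1\<close> by (auto simp: Y_def G_def PiE_iff field_simps less_imp_le)
  have last: "c \<le> \<bar>P ?x (Suc d)\<bar>"
  proof -
    obtain i where i: "i \<le> Suc d" "c \<le> \<bar>P ?x i\<bar>" using big X by blast
    show ?thesis
    proof (cases "i = Suc d")
      case False
      then have "i \<le> d" using i by simp
      then have "\<bar>P ?x i\<bar> = \<bar>Y a i\<bar> * \<bar>P ?x (Suc d)\<bar>" using X(2) by (simp add: abs_mult)
      also have "\<dots> \<le> 1 * \<bar>P ?x (Suc d)\<bar>" using Ybd[OF ab(1) \<open>i \<le> d\<close>] by (intro mult_right_mono) auto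
      finally show ?thesis using i by simp
    qed (use i in simp)
  qed
  obtain i where i: "i \<le> d" "a i \<noteq> b i" 
    using ab PiE_ext[of a "{..d}" _ b] unfolding G_def by (metis atMost_iff)
  then have "1 \<le> \<bar>real (a i) - real (b i)\<bar>" by linarith
  then have "1 / real N \<le> \<bar>Y a i - Y b i\<bar>"
    using \<open>N \<ge> 1\<close> by (simp add: Y_def flip: diff_divide_distrib) (simp add: field_simps)
  then have "c * (1 / real N) \<le> \<bar>P ?x (Suc d)\<bar> * \<bar>Y a i - Y b i\<bar>"
    using last \<open>c > 0\<close> by (intro mult_mono) auto
  also have "\<dots> = \<bar>(P ?x i - P ?y i) + Y b i * (P ?y (Suc d) - P ?x (Suc d))\<bar>"
    using X(2)[OF i(1)] by (simp add: algebra_simps flip: abs_mult)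
  also have "\<dots> \<le> \<bar>P ?x i - P ?y i\<bar> + \<bar>Y b i\<bar> * \<bar>P ?y (Suc d) - P ?x (Suc d)\<bar>"
    by (metis abs_mult abs_triangle_ineq)
  also have "\<dots> \<le> \<bar>P ?x i - P ?y i\<bar> + 1 * \<bar>P ?y (Suc d) - P ?x (Suc d)\<bar>"
    using Ybd[OF ab(2) i(1)] by (intro add_left_mono mult_right_mono) auto
  also have "\<dots> \<le> 2 * (\<bar>L\<bar> * ((real d + 1)\<^sup>2 / real M))"
    using near[of i] near[of "Suc d"] i by (simp add: abs_minus_commute)
  finally have "c * (1 / real N) \<le> 2 * (\<bar>L\<bar> * ((real d + 1)\<^sup>2 / (real m * real N)))"
    by (simp add: M_def)
  then have "c * m \<le> 2 * (\<bar>L\<bar> * (real d + 1)\<^sup>2)"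
    using \<open>N \<ge> 1\<close> \<open>m \<ge> 1\<close> by (simp add: field_simps)
  with m(1) \<open>c > 0\<close> show False by (simp add: field_simps)
qed

section \<open>Borsuk's odd mapping theorem and the Borsuk-Ulam theorem\<close>

text \<open>
  In the induction step \<open>g\<close> is replaced by an odd Lipschitz approximation \<open>P\<close>, whose values on the
  equator avoid the line through some \<open>(y, 1)\<close>. The map \<open>F t\<close> shears this line towards the polar axis
  and at the same time multiplies the last coordinate by a factor that reaches \<open>\<bar>x (Suc d)\<bar>\<close> at
  \<open>t = 1\<close>. So \<open>F 1\<close> preserves the equator, and a zero of \<open>F t\<close> could only occur for \<open>t = 1\<close> at an
  equatorial point where \<open>P\<close> has the avoided direction.
\<close>

theorem odd_Brouwer_degree2_of_odd_map:
  assumes "continuous_map (nsphere d) (nsphere d) g"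
    and "\<And>x. x \<in> topspace (nsphere d) \<Longrightarrow> g (\<lambda>i. - x i) = (\<lambda>i. - g x i)"
  shows "odd (Brouwer_degree2 d g)"
  using assms
proof (induction d arbitrary: g)
  case 0
  have two: "x 0 = 1 \<or> x 0 = -1" "\<And>i. i > 0 \<Longrightarrow> x i = 0" if "x \<in> topspace (nsphere 0)" for x
    using that by (auto simp: mem_nsphere power2_eq_1_iff)
  have "(g \<circ> g) x = id x" if x: "x \<in> topspace (nsphere 0)" for x
  proof -
    have gx: "g x \<in> topspace (nsphere 0)" using "0.prems"(1) x by (auto simp: continuous_map_nsphere_iff)
    then consider "g x = x" | "g x = (\<lambda>i. - x i)"
    proof (cases "g x 0 = x 0")
      case True
      have "g x i = x i" for i using True two(2)[OF x, of i] two(2)[OF gx, of i] by (cases "i = 0") auto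
      then show thesis using that(1) by blast
    next
      case False
      then have "g x 0 = - x 0" using two(1)[OF x] two(1)[OF gx] by auto
      then have "g x i = - x i" for i using two(2)[OF x, of i] two(2)[OF gx, of i] by (cases "i = 0") auto
      then show thesis using that(2) by blast
    qed
    then show ?thesis
    proof cases
      case 2
      have "g (g x) = g (\<lambda>i. - x i)" using 2 by simp
      also have "\<dots> = x" using "0.prems"(2)[OF x] 2 by simp
      finally show ?thesis by simp
    qed simp
  qed
  then have "Brouwer_degree2 0 (g \<circ> g) = Brouwer_degree2 0 id"
    by (rule Brouwer_degree2_eq)
  then have "Brouwer_degree2 0 g * Brouwer_degree2 0 g = 1"
    using Brouwer_degree2_compose[OF "0.prems"(1) "0.prems"(1)] by simp
  then show ?case by (metis even_mult_iff odd_one)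
next
  case (Suc d)
  let ?S = "topspace (nsphere (Suc d))" and ?E = "topspace (nsphere d)"
  have cont: "continuous_on ?S (\<lambda>x. g x i)" for i
    using Suc.prems(1) by (simp add: continuous_map_nsphere_iff)
  have gS: "g x \<in> ?S" if "x \<in> ?S" for x using Suc.prems(1) that by (auto simp: continuous_map_nsphere_iff)
  \<comment> \<open>half of the lower bound for the largest coordinate of a point of the sphere\<close>
  define e where "e = 1 / (2 * (real (Suc d) + 1))"
  have "e > 0" and two_e: "2 * e = 1 / (real (Suc d) + 1)" by (simp_all add: e_def field_simps)
  have "\<exists>z. lipschitz_l1 (Suc d) (snd z) ?S (fst z) \<and> (\<forall>x\<in>?S. \<bar>g x i - fst z x\<bar> < e)
      \<and> (\<forall>x. fst z (\<lambda>i. - x i) = - fst z x)" for i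
  proof (rule lipschitz_odd_approximation[OF cont[of i] _ \<open>e > 0\<close>])
    show "g (\<lambda>i. - x i) i = - g x i" if "x \<in> ?S" for x using Suc.prems(2)[OF that] by simp
    show ?thesis if "lipschitz_l1 (Suc d) L ?S h" "\<And>x. x \<in> ?S \<Longrightarrow> \<bar>g x i - h x\<bar> < e"
      "\<And>x. h (\<lambda>i. - x i) = - h x" for L h
      using that by (intro exI[of _ "(h, L)"]) simp
  qed
  then have "\<forall>i. \<exists>z. lipschitz_l1 (Suc d) (snd z) ?S (fst z) \<and> (\<forall>x\<in>?S. \<bar>g x i - fst z x\<bar> < e)
      \<and> (\<forall>x. fst z (\<lambda>i. - x i) = - fst z x)" by blast
  from choice[OF this] obtain z where z: "\<And>i. lipschitz_l1 (Suc d) (snd (z i)) ?S (fst (z i))"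
    "\<And>i x. x \<in> ?S \<Longrightarrow> \<bar>g x i - fst (z i) x\<bar> < e"
    "\<And>i x. fst (z i) (\<lambda>i. - x i) = - fst (z i) x" by blast
  define h where "h i = fst (z i)" for i
  define L where "L i = snd (z i)" for i
  have hL: "\<And>i. lipschitz_l1 (Suc d) (L i) ?S (h i)" "\<And>i x. x \<in> ?S \<Longrightarrow> \<bar>g x i - h i x\<bar> < e"
    "\<And>i x. h i (\<lambda>i. - x i) = - h i x" using z by (simp_all add: h_def L_def)
  define P where "P x i = h i x" for x i
  have contP: "continuous_on ?S (\<lambda>x. P x i)" for i
    unfolding P_def using lipschitz_l1_imp_continuous_on[OF hL(1)] by simp
  have segment: "\<exists>i\<le>Suc d. e < \<bar>(1 - t) * g x i + t * P x i\<bar>" if x: "x \<in> ?S" and t: "t \<in> {0..1}" for t x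
  proof -
    obtain i where i: "i \<le> Suc d" "2 * e \<le> \<bar>g x i\<bar>"
      using nsphere_large_coord[OF gS[OF x]] unfolding two_e by blast
    have "\<bar>t * (g x i - P x i)\<bar> \<le> 1 * \<bar>g x i - P x i\<bar>"
      unfolding abs_mult using t by (intro mult_right_mono) auto
    also have "\<dots> < e" using hL(2)[OF x] by (simp add: P_def)
    finally have "\<bar>t * (g x i - P x i)\<bar> < e" .
    moreover have "(1 - t) * g x i + t * P x i = g x i - t * (g x i - P x i)" by (simp add: algebra_simps)
    ultimately have "e < \<bar>(1 - t) * g x i + t * P x i\<bar>" using i by linarith
    with i show ?thesis by blast
  qed
  have ES: "?E \<subseteq> ?S" by (auto simp: mem_nsphere)
  have Elast: "x (Suc d) = 0" if "x \<in> ?E" for x using that by (simp add: mem_nsphere)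
  define L' where "L' = (MAX i\<in>{..Suc d}. L i)"
  have lipE: "lipschitz_l1 d L' ?E (\<lambda>x. P x i)" if "i \<le> Suc d" for i
    unfolding lipschitz_l1_def
  proof (intro ballI)
    fix x y assume xy: "x \<in> ?E" "y \<in> ?E"
    have "\<bar>P x i - P y i\<bar> \<le> L i * (\<Sum>i\<le>Suc d. \<bar>x i - y i\<bar>)"
      using hL(1)[of i] xy ES unfolding lipschitz_l1_def P_def by blast
    also have "\<dots> = L i * (\<Sum>i\<le>d. \<bar>x i - y i\<bar>)" using Elast[OF xy(1)] Elast[OF xy(2)] by simp
    also have "\<dots> \<le> L' * (\<Sum>i\<le>d. \<bar>x i - y i\<bar>)"
      unfolding L'_def using that by (intro mult_right_mono sum_nonneg Max_ge) auto
    finally show "\<bar>P x i - P y i\<bar> \<le> L' * (\<Sum>i\<le>d. \<bar>x i - y i\<bar>)" .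
  qed
  obtain y where y: "\<And>x. x \<in> ?E \<Longrightarrow> \<exists>i\<le>d. P x i \<noteq> y i * P x (Suc d)"
  proof (rule lipschitz_image_misses_direction[OF lipE \<open>e > 0\<close>])
    show "\<exists>i\<le>Suc d. e \<le> \<bar>P x i\<bar>" if "x \<in> ?E" for x
      using segment[of x 1] that ES by force
  qed auto
  define F where "F t x i = (if i = Suc d then (1 - t + t * \<bar>x (Suc d)\<bar>) * P x i else P x i - t * y i * P x (Suc d))"
    for t :: real and x and i
  have F_nz: "\<exists>i\<le>Suc d. F t x i \<noteq> 0" if x: "x \<in> ?S" and t: "t \<in> {0..1}" for t x
  proof (rule ccontr)
    assume "\<not> ?thesis"
    then have zero: "F t x i = 0" if "i \<le> Suc d" for i using that by blast
    have rest: "P x i = t * y i * P x (Suc d)" if "i \<le> d" for i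
      using zero[of i] that by (simp add: F_def)
    have "P x (Suc d) \<noteq> 0"
    proof
      assume "P x (Suc d) = 0"
      then have "P x i = 0" if "i \<le> Suc d" for i using rest that by (cases "i = Suc d") auto
      then show False using segment[OF x, of 1] \<open>e > 0\<close> by auto
    qed
    then have "1 - t + t * \<bar>x (Suc d)\<bar> = 0" using zero[of "Suc d"] by (simp add: F_def)
    moreover have "0 \<le> t * \<bar>x (Suc d)\<bar>" using t by simp
    ultimately have "t = 1" using t by auto
    with \<open>1 - t + t * \<bar>x (Suc d)\<bar> = 0\<close> have "x (Suc d) = 0" by simp
    then have "x \<in> ?E" using x topspace_nsphere_minus1[of x "Suc d"] by simp
    then show False using y rest \<open>t = 1\<close> by auto
  qed
  define G where "G x = normalise (Suc d) (F 1 x)" for x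
  have contF: "continuous_on ?S (\<lambda>x. F 1 x i)" for i
    unfolding F_def by (cases "i = Suc d")
      (auto intro!: continuous_intros contP continuous_on_subset[OF continuous_on_product_coordinates])
  define H where "H t x i = (1 - t) * g x i + t * P x i" for t :: real and x i
  have cont_snd: "continuous_on ({0..1::real} \<times> ?S) (\<lambda>z. k (snd z))" if "continuous_on ?S k" for k :: "(nat \<Rightarrow> real) \<Rightarrow> real"
    by (rule continuous_on_compose2[OF that continuous_on_snd[OF continuous_on_id]]) auto
  have coord: "continuous_on ?S (\<lambda>x. x i)" for i
    by (intro continuous_on_subset[OF continuous_on_product_coordinates]) auto
  have "Brouwer_degree2 (Suc d) g = Brouwer_degree2 (Suc d) (\<lambda>x. normalise (Suc d) (H 0 x))"
  proof (rule Brouwer_degree2_eq)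
    fix x assume "x \<in> ?S"
    moreover have "H 0 x = g x" by (simp add: H_def fun_eq_iff)
    ultimately show "g x = normalise (Suc d) (H 0 x)" by (simp add: normalise_ident[OF gS])
  qed
  also have "\<dots> = Brouwer_degree2 (Suc d) (\<lambda>x. normalise (Suc d) (H 1 x))"
  proof (rule Brouwer_degree2_normalise_homotopic)
    show "continuous_on ({0..1} \<times> ?S) (\<lambda>(t, x). H t x i)" for i
      unfolding H_def case_prod_beta by (intro continuous_intros cont_snd cont contP)
    show "\<exists>i\<le>Suc d. H t x i \<noteq> 0" if "t \<in> {0..1}" "x \<in> ?S" for t x
      using segment[OF that(2,1)] \<open>e > 0\<close> unfolding H_def by (metis abs_zero less_asym)
  qed
  also have "H 1 = F 0" by (auto simp: H_def F_def fun_eq_iff)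
  also have "Brouwer_degree2 (Suc d) (\<lambda>x. normalise (Suc d) (F 0 x)) = Brouwer_degree2 (Suc d) G"
    unfolding G_def
  proof (rule Brouwer_degree2_normalise_homotopic)
    show "continuous_on ({0..1} \<times> ?S) (\<lambda>(t, x). F t x i)" for i
      unfolding F_def case_prod_beta
      by (cases "i = Suc d") (auto intro!: continuous_intros cont_snd contP coord)
  qed (use F_nz in blast)
  finally have deg: "Brouwer_degree2 (Suc d) g = Brouwer_degree2 (Suc d) G" .
  have contG: "continuous_on ?S (\<lambda>x. G x i)" for i
    unfolding G_def using F_nz[of _ 1] contF by (intro continuous_on_normalise) auto
  have GS: "G x \<in> ?S" if "x \<in> ?S" for x
    unfolding G_def using F_nz[OF that, of 1] by (intro normalise_mem_nsphere) auto
  have GE: "G x \<in> ?E" if "x \<in> ?E" for x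
  proof -
    have "G x (Suc d) = 0" using Elast[OF that] by (simp add: G_def F_def normalise_def)
    then show ?thesis using topspace_nsphere_minus1[OF GS, of x] that ES by auto
  qed
  have Godd: "G (\<lambda>i. - x i) = (\<lambda>i. - G x i)" for x
  proof -
    have "F 1 (\<lambda>i. - x i) i = - F 1 x i" for i by (simp add: F_def P_def hL(3))
    then show ?thesis by (simp add: G_def normalise_def fun_eq_iff)
  qed
  have "even (Brouwer_degree2 (Suc d) G - Brouwer_degree2 (Suc d - Suc 0) G)"
    by (rule Borsuk_odd_mapping_degree_step)
      (use contG GS GE Godd in \<open>auto simp: continuous_map_nsphere_iff\<close>)
  moreover have "odd (Brouwer_degree2 d G)"
  proof (rule Suc.IH)
    show "continuous_map (nsphere d) (nsphere d) G"
      using GE ES contG by (auto simp: continuous_map_nsphere_iff intro: continuous_on_subset)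
  qed (rule Godd)
  ultimately show ?case unfolding deg by simp
qed

text \<open>
  A nonvanishing \<open>h\<close> would, after normalisation, be an odd self-map of the sphere that misses the
  pole; its degree would be both odd and zero.
\<close>

theorem Borsuk_Ulam:
  fixes h :: "(nat \<Rightarrow> real) \<Rightarrow> nat \<Rightarrow> real"
  assumes cont: "\<And>i. continuous_on (topspace (nsphere d)) (\<lambda>x. h x i)"
    and odd: "\<And>x. x \<in> topspace (nsphere d) \<Longrightarrow> h (\<lambda>i. - x i) = (\<lambda>i. - h x i)"
    and target: "\<And>x i. x \<in> topspace (nsphere d) \<Longrightarrow> d \<le> i \<Longrightarrow> h x i = 0"
  shows "\<exists>x\<in>topspace (nsphere d). h x = (\<lambda>i. 0)"
proof (rule ccontr)
  let ?S = "topspace (nsphere d)"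
  assume "\<not> ?thesis"
  then have nz: "h x \<noteq> (\<lambda>i. 0)" if "x \<in> ?S" for x using that by blast
  have nz': "\<exists>i\<le>d. h x i \<noteq> 0" if x: "x \<in> ?S" for x
    using nz[OF x] target[OF x] by (metis nat_le_linear)
  let ?g = "\<lambda>x. normalise d (h x)"
  have g: "continuous_map (nsphere d) (nsphere d) ?g"
    using cont nz' by (auto simp: continuous_map_nsphere_iff intro: continuous_on_normalise normalise_mem_nsphere)
  have "odd (Brouwer_degree2 d ?g)"
    using g by (rule odd_Brouwer_degree2_of_odd_map) (simp add: odd normalise_def fun_eq_iff)
  moreover have "(\<lambda>i. if i = d then 1 else 0) \<in> ?S - ?g ` ?S"
  proof -
    have "?g x d = 0" if "x \<in> ?S" for x using target[OF that, of d] by (simp add: normalise_def)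
    moreover have "(\<lambda>i. if i = d then 1 else 0) \<in> ?S"
      by (simp add: mem_nsphere if_distrib[of "\<lambda>x. x\<^sup>2"] cong: if_cong)
    moreover have "?g x \<noteq> (\<lambda>i. if i = d then 1 else 0)" if "?g x d = 0" for x
      using that by (auto dest: fun_cong)
    ultimately show ?thesis by (metis (no_types, lifting) DiffI imageE)
  qed
  then have "?g ` ?S \<noteq> ?S" by blast
  ultimately show False using Brouwer_degree2_nonsurjective[OF g] by simp
qed

section \<open>Genus of block spaces\<close>

lemma closed_p_sphere:
  fixes V :: "'a set"
  assumes "p > 0"
  shows "closed (p_sphere V p)"
proof -
  have "p_sphere V p = {g. (\<Sum>v\<in>V. \<bar>g v\<bar> powr p) = 1} \<inter> (\<Inter>v\<in>- V. {g. g v = 0})"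
    by (auto simp: p_sphere_def)
  moreover have "closed \<dots>"
    by (intro closed_Int closed_INT ballI closed_Collect_eq continuous_intros
        continuous_on_product_coordinates continuous_on_powr') (use assms in auto)
  ultimately show ?thesis by simp
qed

text \<open>
  The element with coordinates \<open>c\<close> of the \<open>k\<close>-dimensional space spanned by the restrictions of \<open>w\<close>
  to the blocks \<open>0, \<dots>, k - 1\<close>.
\<close>

definition block_fun :: "'a set \<Rightarrow> nat \<Rightarrow> ('a \<Rightarrow> nat) \<Rightarrow> ('a \<Rightarrow> real) \<Rightarrow> (nat \<Rightarrow> real) \<Rightarrow> 'a \<Rightarrow> real" where
  "block_fun V k b w c u = (if u \<in> V \<and> b u < k then c (b u) * w u else 0)"

text \<open>
  Normalising \<open>block_fun V k b w\<close> gives an odd map from the \<open>(k - 1)\<close>-dimensional sphere of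
  coordinates into this set. Composed with an odd map to a punctured space of dimension below \<open>k\<close> it
  would contradict the Borsuk-Ulam theorem.
\<close>

lemma block_span_mem_genus_family:
  fixes V :: "'a set" and b :: "'a \<Rightarrow> nat" and w :: "'a \<Rightarrow> real"
  assumes "finite V" and "p > 0" and "k \<ge> 1"
    and hit: "\<And>i. i < k \<Longrightarrow> \<exists>u\<in>V. b u = i \<and> w u \<noteq> 0"
  shows "p_sphere V p \<inter> range (block_fun V k b w) \<in> genus_family V p k"
proof -
  let ?A = "p_sphere V p \<inter> range (block_fun V k b w)"
  let ?S = "topspace (nsphere (k - 1))"
  \<comment> \<open>representatives of the blocks, which turn membership in the span into closed conditions\<close>
  have "\<forall>i\<in>{..<k}. \<exists>u. u \<in> V \<and> b u = i \<and> w u \<noteq> 0" using hit by blast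
  from bchoice[OF this] obtain r where r: "\<And>i. i < k \<Longrightarrow> r i \<in> V \<and> b (r i) = i \<and> w (r i) \<noteq> 0" by blast
  have "range (block_fun V k b w) =
      (\<Inter>u\<in>{u\<in>V. b u < k}. {g. g u * w (r (b u)) = g (r (b u)) * w u}) \<inter> (\<Inter>u\<in>- {u\<in>V. b u < k}. {g. g u = 0})"
    (is "_ = ?C")
  proof (intro equalityI subsetI)
    fix g assume "g \<in> ?C"
    then have g: "\<And>u. u \<in> V \<Longrightarrow> b u < k \<Longrightarrow> g u * w (r (b u)) = g (r (b u)) * w u"
      "\<And>u. \<not> (u \<in> V \<and> b u < k) \<Longrightarrow> g u = 0" by auto
    have "g = block_fun V k b w (\<lambda>i. g (r i) / w (r i))"
      using g r by (auto simp: block_fun_def fun_eq_iff field_simps)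
    then show "g \<in> range (block_fun V k b w)" by blast
  qed (use r in \<open>auto simp: block_fun_def split: if_splits\<close>)
  moreover have "closed ?C"
    by (intro closed_Int closed_INT ballI closed_Collect_eq continuous_intros continuous_on_product_coordinates)
  ultimately have "closed (range (block_fun V k b w))" by (rule ssubst)
  then have closed: "closed ?A" by (intro closed_Int closed_p_sphere \<open>p > 0\<close>)
  have uminus: "(\<lambda>v. - g v) \<in> ?A" if gA: "g \<in> ?A" for g
  proof -
    obtain c where "g = block_fun V k b w c" using gA by blast
    then have "(\<lambda>v. - g v) = block_fun V k b w (\<lambda>i. - c i)" by (auto simp: block_fun_def fun_eq_iff)
    moreover have "(\<lambda>v. - g v) \<in> p_sphere V p" using gA by (simp add: p_sphere_def)
    ultimately show ?thesis by blast
  qed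
  have "symmetric_set ?A"
    unfolding symmetric_set_def
  proof (intro equalityI subsetI)
    fix g assume "g \<in> ?A"
    then have "g = (\<lambda>v. - (\<lambda>v. - g v) v)" "(\<lambda>v. - g v) \<in> ?A" using uminus by auto
    then show "g \<in> (\<lambda>g v. - g v) ` ?A" by (rule image_eqI)
  qed (use uminus in blast)
  moreover have "enat k \<le> genus ?A"
  proof -
    define N where "N x = (\<Sum>v\<in>V. \<bar>block_fun V k b w x v\<bar> powr p)" for x
    define \<phi> where "\<phi> x v = block_fun V k b w x v / N x powr (1 / p)" for x v
    have N_pos: "N x > 0" if xS: "x \<in> ?S" for x
    proof -
      obtain i where "i \<le> k - 1" "x i \<noteq> 0" using nsphere_large_coord[OF xS] by force
      then have "i < k" using \<open>k \<ge> 1\<close> by simp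
      then have "block_fun V k b w x (r i) \<noteq> 0" using r[of i] \<open>x i \<noteq> 0\<close> by (auto simp: block_fun_def)
      then show ?thesis
        unfolding N_def using r[OF \<open>i < k\<close>] \<open>finite V\<close> by (intro sum_pos2[of V "r i"]) auto
    qed
    then have N_ne: "N x \<noteq> 0" if "x \<in> ?S" for x using that by force
    have \<phi>A: "\<phi> x \<in> ?A" if "x \<in> ?S" for x
    proof
      have "\<phi> x = block_fun V k b w (\<lambda>i. x i / N x powr (1 / p))"
        by (auto simp: \<phi>_def block_fun_def)
      then show "\<phi> x \<in> range (block_fun V k b w)" by blast
      have "\<bar>\<phi> x v\<bar> powr p = \<bar>block_fun V k b w x v\<bar> powr p / N x" for v
        using N_pos[OF that] \<open>p > 0\<close> by (simp add: \<phi>_def abs_divide powr_divide powr_powr)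
      then have "(\<Sum>v\<in>V. \<bar>\<phi> x v\<bar> powr p) = 1"
        using N_pos[OF that] by (simp add: flip: sum_divide_distrib N_def)
      then show "\<phi> x \<in> p_sphere V p" by (auto simp: p_sphere_def \<phi>_def block_fun_def)
    qed
    have cont_block: "continuous_on ?S (\<lambda>x. block_fun V k b w x v)" for v
      unfolding block_fun_def
      by (cases "v \<in> V \<and> b v < k") (auto intro!: continuous_intros continuous_on_subset[OF continuous_on_product_coordinates])
    have contN: "continuous_on ?S N"
      unfolding N_def by (intro continuous_intros continuous_on_powr' cont_block) (use \<open>p > 0\<close> in auto)
    have "continuous_on ?S (\<lambda>x. \<phi> x v)" for v
      unfolding \<phi>_def by (intro continuous_on_divide continuous_on_powr cont_block continuous_on_const
          contN)
        (use N_ne in auto)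
    then have cont_\<phi>: "continuous_on ?S \<phi>" by (rule continuous_on_coordinatewise_then_product)
    have odd_\<phi>: "\<phi> (\<lambda>i. - x i) = (\<lambda>v. - \<phi> x v)" for x
    proof -
      have "block_fun V k b w (\<lambda>i. - x i) v = - block_fun V k b w x v" for v by (simp add: block_fun_def)
      then show ?thesis by (simp add: \<phi>_def N_def fun_eq_iff)
    qed
    have "?A \<noteq> {}" using \<phi>A in_topspace_nsphere by blast
    moreover have least: "k \<le> m" if h: "odd_map_to_punctured ?A m h" for m h
    proof (rule ccontr)
      assume "\<not> k \<le> m"
      have cont_h: "continuous_on ?A h" and zero_h: "\<And>g i. g \<in> ?A \<Longrightarrow> m \<le> i \<Longrightarrow> h g i = 0"
        using h by (auto simp: odd_map_to_punctured_def Euclidean_space_def euclidean_product_topology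
            continuous_map_in_subtopology image_subset_iff)
      have "continuous_on ?S (\<lambda>x. h (\<phi> x))"
        by (rule continuous_on_compose2[OF cont_h cont_\<phi>]) (use \<phi>A in blast)
      then have "continuous_on ?S (\<lambda>x. h (\<phi> x) i)" for i
        by (rule continuous_on_product_then_coordinatewise)
      then have "\<exists>x\<in>?S. h (\<phi> x) = (\<lambda>i. 0)"
      proof (rule Borsuk_Ulam)
        show "h (\<phi> (\<lambda>i. - x i)) = (\<lambda>i. - h (\<phi> x) i)" if "x \<in> ?S" for x
          using h \<phi>A[OF that] unfolding odd_\<phi> by (auto simp: odd_map_to_punctured_def)
        show "h (\<phi> x) i = 0" if "x \<in> ?S" "k - 1 \<le> i" for x i
          using zero_h[OF \<phi>A[OF that(1)]] that \<open>\<not> k \<le> m\<close> by auto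
      qed
      then show False using h \<phi>A by (auto simp: odd_map_to_punctured_def)
    qed
    from least have "enat k \<le> Inf {enat m |m. \<exists>h. odd_map_to_punctured ?A m h}"
      by (intro Inf_greatest) auto
    ultimately show ?thesis by (simp add: genus_def)
  qed
  ultimately show ?thesis using closed by (auto simp: genus_family_def)
qed

section \<open>The p-power\<close>

lemma p_power_0 [simp]: "p_power p 0 = 0"
  by (simp add: p_power_def)

lemma p_power_minus: "p_power p (- x) = - p_power p x"
  by (simp add: p_power_def)

lemma p_power_eq_sgn: "p_power p x = sgn x * \<bar>x\<bar> powr (p - 1)"
proof (cases "x = 0")
  case False
  then have "\<bar>x\<bar> powr (p - 2) * \<bar>x\<bar> = \<bar>x\<bar> powr (p - 1)"
    using powr_add[of "\<bar>x\<bar>" "p - 2" 1] by simp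
  then show ?thesis using False
    by (metis (no_types, opaque_lifting) p_power_def mult.assoc mult.commute sgn_mult_abs)
qed simp

lemma p_power_of_nonneg: "x \<ge> 0 \<Longrightarrow> p_power p x = x powr (p - 1)"
  by (cases "x = 0") (simp_all add: p_power_eq_sgn)

lemma p_power_mult_self: "p > 1 \<Longrightarrow> p_power p x * x = \<bar>x\<bar> powr p"
proof (cases "x = 0")
  case False
  then show ?thesis using powr_add[of "\<bar>x\<bar>" "p - 1" 1]
    by (simp add: p_power_eq_sgn mult.assoc) (metis abs_sgn mult.commute mult.left_commute)
qed simp

text \<open>
  The conjugate exponent gives the inverse function, since \<open>p / (p - 1) - 1 = 1 / (p - 1)\<close>.
\<close>

lemma p_power_inverse:
  assumes "p > 1"
  shows "p_power (p / (p - 1)) (p_power p x) = x" and "p_power p (p_power (p / (p - 1)) x) = x"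
proof -
  have 1: "p / (p - 1) - 1 = 1 / (p - 1)" using assms by (simp add: field_simps)
  show "p_power (p / (p - 1)) (p_power p x) = x" "p_power p (p_power (p / (p - 1)) x) = x"
    using assms unfolding p_power_eq_sgn 1
    by (cases "x = 0"; simp add: sgn_mult abs_mult powr_powr powr_mult sgn_mult_abs mult.assoc)+
qed

lemma p_power_inj: "p > 1 \<Longrightarrow> p_power p x = p_power p y \<longleftrightarrow> x = y"
  by (metis p_power_inverse(1))

lemma p_power_eq_0_iff: "p > 1 \<Longrightarrow> p_power p x = 0 \<longleftrightarrow> x = 0"
  using p_power_inj[of p x 0] by simp

lemma continuous_on_p_power [continuous_intros]:
  assumes "p > 1" and "continuous_on S f"
  shows "continuous_on S (\<lambda>x. p_power p (f x))"
proof -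
  have "p_power p y = max y 0 powr (p - 1) - max (- y) 0 powr (p - 1)" for y
    by (cases "y \<ge> 0") (auto simp: p_power_eq_sgn sgn_if max_def)
  moreover have "continuous_on S (\<lambda>x. max (f x) 0 powr (p - 1) - max (- f x) 0 powr (p - 1))"
    using assms by (intro continuous_intros continuous_on_powr') auto
  ultimately show ?thesis by simp
qed

section \<open>Edge inequalities\<close>

lemma abs_powr_convex:
  fixes p a b x y :: real
  assumes "p > 1" "a \<ge> 0" "b \<ge> 0" "a + b = 1"
  shows "\<bar>a * x + b * y\<bar> powr p \<le> a * \<bar>x\<bar> powr p + b * \<bar>y\<bar> powr p"
proof -
  have zero: "(b * t) powr p \<le> b * t powr p" if "b \<ge> 0" "b \<le> 1" "t \<ge> 0" for b t :: real
  proof -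
    have "b powr p \<le> b" using that assms(1) powr_mono'[of 1 p b] by simp
    then show ?thesis using that by (simp add: powr_mult mult_right_mono)
  qed
  have "\<bar>a * x + b * y\<bar> powr p \<le> (a * \<bar>x\<bar> + b * \<bar>y\<bar>) powr p"
    using assms by (intro powr_mono2) (auto intro: order_trans[OF abs_triangle_ineq] simp: abs_mult)
  also have "\<dots> \<le> a * \<bar>x\<bar> powr p + b * \<bar>y\<bar> powr p"
  proof (cases "x = 0 \<or> y = 0")
    case True
    then show ?thesis using zero[of a "\<bar>x\<bar>"] zero[of b "\<bar>y\<bar>"] assms by auto
  next
    case False
    then have "(a *\<^sub>R \<bar>x\<bar> + b *\<^sub>R \<bar>y\<bar>) powr p \<le> a * \<bar>x\<bar> powr p + b * \<bar>y\<bar> powr p"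
      using assms powr_convex[of p] unfolding convex_on_def by (auto simp del: real_scaleR_def)
    then show ?thesis by simp
  qed
  finally show ?thesis .
qed

lemma abs_powr_weighted_convex:
  fixes p a b c d :: real
  assumes "p > 1" "a \<ge> 0" "b \<ge> 0" "a + b > 0"
  shows "\<bar>c * a + d * b\<bar> powr p \<le> (a + b) powr (p - 1) * (\<bar>c\<bar> powr p * a + \<bar>d\<bar> powr p * b)"
proof -
  let ?s = "a + b"
  have "\<bar>c * a + d * b\<bar> = ?s * \<bar>a / ?s * c + b / ?s * d\<bar>"
  proof -
    have "c * a + d * b = ?s * (a / ?s * c + b / ?s * d)" using assms by (simp add: distrib_left)
    then show ?thesis using assms by (metis abs_mult abs_of_pos)
  qed
  then have "\<bar>c * a + d * b\<bar> powr p = ?s powr p * \<bar>a / ?s * c + b / ?s * d\<bar> powr p"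
    using assms by (simp add: powr_mult)
  also have "\<dots> \<le> ?s powr p * (a / ?s * \<bar>c\<bar> powr p + b / ?s * \<bar>d\<bar> powr p)"
    using assms by (intro mult_left_mono abs_powr_convex) (auto simp flip: add_divide_distrib)
  also have "\<dots> = ?s powr p / ?s * (\<bar>c\<bar> powr p * a + \<bar>d\<bar> powr p * b)"
    by (simp add: algebra_simps add_divide_distrib)
  also have "?s powr p / ?s = ?s powr (p - 1)" using assms by (simp add: powr_diff)
  finally show ?thesis .
qed

lemma edge_energy_eq:
  assumes "p > 1" and "c = d \<or> a = 0 \<or> b = 0"
  shows "\<bar>c * a - d * b\<bar> powr p = p_power p (a - b) * (\<bar>c\<bar> powr p * a - \<bar>d\<bar> powr p * b)"
proof -
  have "\<bar>e * a - e * b\<bar> powr p = p_power p (a - b) * (\<bar>e\<bar> powr p * a - \<bar>e\<bar> powr p * b)" for e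
    using p_power_mult_self[OF assms(1), of "a - b"]
    by (simp add: abs_mult powr_mult mult.left_commute[of "p_power p (a - b)"] flip: right_diff_distrib)
  from this[of c] this[of d] show ?thesis using assms(2) by auto
qed

text \<open>
  For values of opposite sign, \<open>c * a - d * b\<close> is \<open>a - b\<close> times a weighted mean of \<open>c\<close> and \<open>d\<close>, and
  convexity bounds its \<open>p\<close>-th power from above.
\<close>

lemma edge_energy_le:
  assumes "p > 1" and "a * b \<le> 0"
  shows "\<bar>c * a - d * b\<bar> powr p \<le> p_power p (a - b) * (\<bar>c\<bar> powr p * a - \<bar>d\<bar> powr p * b)"
proof -
  have *: "\<bar>c * a - d * b\<bar> powr p \<le> p_power p (a - b) * (\<bar>c\<bar> powr p * a - \<bar>d\<bar> powr p * b)"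
    if "a \<ge> 0" "b \<le> 0" for a b c d
  proof (cases "a = 0 \<and> b = 0")
    case False
    then have "\<bar>c * a + d * - b\<bar> powr p \<le> (a + - b) powr (p - 1) * (\<bar>c\<bar> powr p * a + \<bar>d\<bar> powr p * - b)"
      using that assms(1) by (intro abs_powr_weighted_convex) auto
    then show ?thesis using that by (simp add: p_power_of_nonneg)
  qed simp
  show ?thesis
  proof (cases "a \<ge> 0 \<and> b \<le> 0")
    case False
    then have "b \<ge> 0" "a \<le> 0" using assms(2) by (auto simp: mult_le_0_iff)
    then have "\<bar>d * b - c * a\<bar> powr p \<le> p_power p (b - a) * (\<bar>d\<bar> powr p * b - \<bar>c\<bar> powr p * a)"
      by (rule *)
    then show ?thesis using p_power_minus[of p "a - b"] by (simp add: abs_minus_commute algebra_simps)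
  qed (use * in blast)
qed

text \<open>
  The discrete Picone inequality. It is the same convexity statement read differently: for
  \<open>a > b > 0\<close> the number \<open>c\<close> is the weighted mean of \<open>d\<close> and of the quotient
  \<open>(c * a - d * b) / (a - b)\<close>, with weights \<open>b / a\<close> and \<open>1 - b / a\<close>.
\<close>

lemma edge_energy_ge:
  assumes "p > 1" and "a * b > 0"
  shows "p_power p (a - b) * (\<bar>c\<bar> powr p * a - \<bar>d\<bar> powr p * b) \<le> \<bar>c * a - d * b\<bar> powr p"
proof -
  have pos: "p_power p (a - b) * (\<bar>c\<bar> powr p * a - \<bar>d\<bar> powr p * b) \<le> \<bar>c * a - d * b\<bar> powr p"
    if "0 < b" "b < a" for a b c d
  proof -
    define t where "t = (c * a - d * b) / (a - b)"
    have t: "c * a - d * b = t * (a - b)" using that by (simp add: t_def)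
    have "a powr (p - 1) * (\<bar>c\<bar> powr p * a) = \<bar>c * a\<bar> powr p"
      using that by (simp add: abs_mult powr_mult powr_diff)
    also have "c * a = d * b + t * (a - b)" using t by simp
    also have "\<bar>\<dots>\<bar> powr p \<le> (b + (a - b)) powr (p - 1) * (\<bar>d\<bar> powr p * b + \<bar>t\<bar> powr p * (a - b))"
      using that assms(1) by (intro abs_powr_weighted_convex) auto
    finally have "a powr (p - 1) * (\<bar>c\<bar> powr p * a) \<le> a powr (p - 1) * (\<bar>d\<bar> powr p * b + \<bar>t\<bar> powr p * (a - b))"
      by simp
    then have "\<bar>c\<bar> powr p * a - \<bar>d\<bar> powr p * b \<le> \<bar>t\<bar> powr p * (a - b)"
      using that by (simp add: mult_le_cancel_left_pos)
    then have "p_power p (a - b) * (\<bar>c\<bar> powr p * a - \<bar>d\<bar> powr p * b) \<le> p_power p (a - b) * (\<bar>t\<bar> powr p * (a - b))"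
      using that by (intro mult_left_mono) (auto simp: p_power_of_nonneg)
    also have "\<dots> = \<bar>t\<bar> powr p * \<bar>a - b\<bar> powr p"
      using p_power_mult_self[OF assms(1), of "a - b"] by (simp add: mult.left_commute[of "p_power p (a - b)"])
    also have "\<dots> = \<bar>c * a - d * b\<bar> powr p"
      unfolding t by (simp add: abs_mult powr_mult)
    finally show ?thesis .
  qed
  have both_pos: "p_power p (a - b) * (\<bar>c\<bar> powr p * a - \<bar>d\<bar> powr p * b) \<le> \<bar>c * a - d * b\<bar> powr p"
    if "0 < a" "0 < b" for a b
  proof (cases a b rule: linorder_cases)
    case less
    from pos[OF that(1) this, of d c] show ?thesis
      using p_power_minus[of p "a - b"] by (simp add: abs_minus_commute algebra_simps)
  qed (use pos that in auto)
  show ?thesis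
  proof (cases "a > 0")
    case False
    then have "- a > 0" "- b > 0" using assms(2) by (auto simp: zero_less_mult_iff)
    from both_pos[OF this] show ?thesis
      using p_power_minus[of p "a - b"] by (simp add: abs_minus_commute algebra_simps)
  qed (use both_pos assms(2) in \<open>auto simp: zero_less_mult_iff\<close>)
qed


section \<open>Solutions of the three-term recurrence\<close>

text \<open>
  The convention \<open>F 0 = F 1\<close> makes the equation at the first vertex an instance of the equation at an
  interior vertex.
\<close>

definition p_solution :: "real \<Rightarrow> real \<Rightarrow> (nat \<Rightarrow> real) \<Rightarrow> bool" where
  "p_solution p lam F \<longleftrightarrow> F 0 = F 1 \<and>
     (\<forall>u. p_power p (F (Suc u) - F (Suc (Suc u))) = p_power p (F u - F (Suc u)) + lam * p_power p (F (Suc u)))"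

fun shoot :: "real \<Rightarrow> real \<Rightarrow> real \<Rightarrow> nat \<Rightarrow> real" where
  "shoot p a lam 0 = a"
| "shoot p a lam (Suc 0) = a"
| "shoot p a lam (Suc (Suc u)) = shoot p a lam (Suc u) -
     p_power (p / (p - 1)) (p_power p (shoot p a lam u - shoot p a lam (Suc u)) + lam * p_power p (shoot p a lam (Suc u)))"

lemma p_solution_shoot: "p > 1 \<Longrightarrow> p_solution p lam (shoot p a lam)"
  by (simp add: p_solution_def p_power_inverse)

lemma continuous_on_shoot:
  assumes "p > 1"
  shows "continuous_on UNIV (\<lambda>lam. shoot p a lam u)"
proof (induction u rule: less_induct)
  case (less u)
  have "p / (p - 1) > 1" using assms by (simp add: field_simps)
  consider "u = 0" | "u = Suc 0" | v where "u = Suc (Suc v)" by (metis nat.exhaust)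
  then show ?case
  proof cases
    case 3
    then show ?thesis
      using less.IH[of v] less.IH[of "Suc v"] assms \<open>p / (p - 1) > 1\<close> by (auto intro!: continuous_intros)
  qed auto
qed

lemma p_solution_no_adjacent_zeros:
  assumes "p > 1" "p_solution p lam F" "F 1 \<noteq> 0"
  shows "F u \<noteq> 0 \<or> F (Suc u) \<noteq> 0"
proof (induction u)
  case 0
  then show ?case using assms by (simp add: p_solution_def)
next
  case (Suc u)
  have "p_power p (F (Suc u) - F (Suc (Suc u))) = p_power p (F u - F (Suc u)) + lam * p_power p (F (Suc u))"
    using assms(2) by (simp add: p_solution_def)
  then have "F u = 0" if "F (Suc u) = 0" "F (Suc (Suc u)) = 0"
    using that p_power_eq_0_iff[OF assms(1)] by simp
  then show ?case using Suc by blast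
qed

lemma p_solution_zero:
  assumes "p > 1" "p_solution p lam F" "F 1 \<noteq> 0" "F (Suc u) = 0"
  shows "F u * F (Suc (Suc u)) < 0"
proof -
  have "p_power p (F (Suc u) - F (Suc (Suc u))) = p_power p (F u - F (Suc u)) + lam * p_power p (F (Suc u))"
    using assms(2) by (simp add: p_solution_def)
  then have "F (Suc (Suc u)) = - F u"
    using assms(4) p_power_inj[OF assms(1), of "- F (Suc (Suc u))" "F u"] by auto
  moreover have "F u \<noteq> 0" using p_solution_no_adjacent_zeros[OF assms(1-3), of u] assms(4) by blast
  ultimately show ?thesis by (simp add: zero_less_mult_iff) linarith
qed

lemma p_laplacian_path:
  assumes "u \<in> {1..n}"
  shows "p_laplacian (path_verts n) (path_weight n) p f u =
    (if u > 1 then p_power p (f u - f (u - 1)) else 0) + (if u < n then p_power p (f u - f (Suc u)) else 0)"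
proof -
  have "p_laplacian (path_verts n) (path_weight n) p f u =
     (\<Sum>v\<in>{1..n}. (if v = u - 1 then p_power p (f u - f v) else 0) + (if v = Suc u then p_power p (f u - f v) else 0))"
    unfolding p_laplacian_def path_verts_def
    using assms by (intro sum.cong) (auto simp: path_weight_def path_edges_def path_verts_def)
  also have "\<dots> = (if u > 1 then p_power p (f u - f (u - 1)) else 0) + (if u < n then p_power p (f u - f (Suc u)) else 0)"
    using assms by (auto simp: sum.distrib)
  finally show ?thesis .
qed

text \<open>
  At the last vertex the eigenvalue equation has no successor term; if \<open>f n = 0\<close>, it forces the
  neighbour to vanish as well, and adjacent zeros are impossible.
\<close>

lemma p_eigenfunction_path_solution:
  assumes "p > 1" "n \<ge> 1" and ef: "p_eigenfunction (path_verts n) (path_weight n) p lam f"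
  defines "F \<equiv> shoot p (f 1) lam"
  shows "\<And>u. u \<in> {1..n} \<Longrightarrow> f u = F u" and "f 1 \<noteq> 0" and "f n \<noteq> 0"
proof -
  note sol = p_solution_shoot[OF assms(1), of lam "f 1", folded F_def]
  then have rec: "p_power p (F (Suc u) - F (Suc (Suc u))) = p_power p (F u - F (Suc u)) + lam * p_power p (F (Suc u))" for u
    by (simp add: p_solution_def)
  have lap: "(if u > 1 then p_power p (f u - f (u - 1)) else 0) + (if u < n then p_power p (f u - f (Suc u)) else 0)
      = lam * p_power p (f u)" if "u \<in> {1..n}" for u
  proof -
    have "p_laplacian (path_verts n) (path_weight n) p f u = lam * p_power p (f u)"
      using ef that unfolding p_eigenfunction_def path_verts_def by blast
    then show ?thesis unfolding p_laplacian_path[OF that] .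
  qed
  have swap: "p_power p (x - y) = - p_power p (y - x)" for x y
    using p_power_minus[of p "y - x"] by simp
  show eq: "f u = F u" if "u \<in> {1..n}" for u
    using that
  proof (induction u rule: less_induct)
    case (less u)
    consider "u = 1" | "u = 2" | v where "u = Suc (Suc (Suc v))"
      using less.prems by (metis One_nat_def Suc_1 atLeastAtMost_iff nat.exhaust not_less_eq_eq zero_le)
    then show ?case
    proof cases
      case 2
      then have "p_power p (f 1 - f 2) = lam * p_power p (f 1)"
        using lap[of 1] less.prems by (simp add: numeral_2_eq_2)
      moreover have "p_power p (F 1 - F 2) = lam * p_power p (f 1)"
        using rec[of 0] by (simp add: F_def numeral_2_eq_2)
      ultimately have "p_power p (f 1 - f 2) = p_power p (f 1 - F 2)" by (simp add: F_def)
      then have "f 1 - f 2 = f 1 - F 2" by (simp only: p_power_inj[OF assms(1)])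
      then show ?thesis using 2 by simp
    next
      case 3
      have IH: "f (Suc v) = F (Suc v)" "f (Suc (Suc v)) = F (Suc (Suc v))"
        using less.IH[of "Suc v"] less.IH[of "Suc (Suc v)"] less.prems 3 by auto
      have "p_power p (F (Suc (Suc v)) - f u) = p_power p (F (Suc (Suc v)) - F u)"
        using lap[of "Suc (Suc v)"] rec[of "Suc v"] less.prems 3 IH swap[of "F (Suc (Suc v))" "F (Suc v)"]
        by simp
      then show ?thesis using p_power_inj[OF assms(1)] by auto
    qed (simp add: F_def)
  qed
  show f1: "f 1 \<noteq> 0"
  proof
    assume "f 1 = 0"
    then have "F u = 0 \<and> F (Suc u) = 0" for u
      by (induction u) (auto simp: F_def)
    then show False using ef eq by (auto simp: p_eigenfunction_def path_verts_def)
  qed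
  show "f n \<noteq> 0"
  proof
    assume fn: "f n = 0"
    with f1 \<open>n \<ge> 1\<close> obtain v where v: "n = Suc (Suc v)"
      by (metis One_nat_def Suc_le_D nat.exhaust)
    then have "f (Suc v) = 0"
      using lap[of n] fn p_power_eq_0_iff[OF assms(1)] by simp
    then show False
      using p_solution_no_adjacent_zeros[OF assms(1) sol, of "Suc v"] f1 fn v eq[of "Suc v"] eq[of n]
      by (simp add: F_def)
  qed
qed

section \<open>Energy\<close>

lemma sum_by_parts:
  fixes D q :: "nat \<Rightarrow> real"
  assumes "D 0 = 0" "n \<ge> 1"
  shows "(\<Sum>u\<in>{1..<n}. D u * (q u - q (Suc u))) = (\<Sum>u\<in>{1..<n}. (D u - D (u - 1)) * q u) - D (n - 1) * q n"
  using \<open>n \<ge> 1\<close>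
proof (induction n rule: dec_induct)
  case base
  then show ?case using assms by simp
next
  case (step n)
  then show ?case by (simp add: algebra_simps)
qed

text \<open>
  Summation by parts against the differences of \<open>F\<close>, which the recurrence turns into
  \<open>lam * p_power p (F u)\<close>. The assumption \<open>c n = 0\<close> removes the boundary term, where the
  recurrence involves the value of \<open>F\<close> beyond the path.
\<close>

lemma p_solution_energy:
  assumes "p > 1" "p_solution p lam F" "n \<ge> 1" "c n = 0"
  shows "(\<Sum>u\<in>{1..<n}. p_power p (F u - F (Suc u)) * (\<bar>c u\<bar> powr p * F u - \<bar>c (Suc u)\<bar> powr p * F (Suc u)))
    = lam * (\<Sum>u\<in>{1..n}. \<bar>c u * F u\<bar> powr p)"
proof -
  let ?D = "\<lambda>u. p_power p (F u - F (Suc u))"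
  have "?D 0 = 0" using assms(2) by (simp add: p_solution_def)
  have step: "(?D u - ?D (u - 1)) * (\<bar>c u\<bar> powr p * F u) = lam * \<bar>c u * F u\<bar> powr p" if "u \<in> {1..<n}" for u
  proof -
    have "?D u - ?D (u - 1) = lam * p_power p (F u)"
      using assms(2) that by (cases u) (auto simp: p_solution_def)
    then show ?thesis
      using p_power_mult_self[OF assms(1), of "F u"] by (simp add: abs_mult powr_mult) 
  qed
  have "(\<Sum>u\<in>{1..<n}. ?D u * (\<bar>c u\<bar> powr p * F u - \<bar>c (Suc u)\<bar> powr p * F (Suc u)))
      = (\<Sum>u\<in>{1..<n}. (?D u - ?D (u - 1)) * (\<bar>c u\<bar> powr p * F u))"
    using sum_by_parts[of ?D n "\<lambda>u. \<bar>c u\<bar> powr p * F u", OF \<open>?D 0 = 0\<close> assms(3)] assms(4) by simp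
  also have "\<dots> = (\<Sum>u\<in>{1..<n}. lam * \<bar>c u * F u\<bar> powr p)" using step by (intro sum.cong) auto
  also have "\<dots> = lam * (\<Sum>u\<in>{1..n}. \<bar>c u * F u\<bar> powr p)"
    using assms(3,4) by (simp add: sum.last_plus flip: sum_distrib_left)
  finally show ?thesis .
qed

definition path_energy :: "real \<Rightarrow> nat \<Rightarrow> (nat \<Rightarrow> real) \<Rightarrow> real" where
  "path_energy p n g = (\<Sum>u\<in>{1..<n}. \<bar>g u - g (Suc u)\<bar> powr p)"

lemma p_rayleigh_path:
  "p_rayleigh (path_verts n) (path_weight n) p g = path_energy p n g / (\<Sum>u\<in>{1..n}. \<bar>g u\<bar> powr p)"
proof -
  let ?G = "\<lambda>u v. \<bar>g u - g v\<bar> powr p"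
  have "(\<Sum>u\<in>{1..n}. \<Sum>v\<in>{1..n}. path_weight n u v * ?G u v) =
     (\<Sum>u\<in>{1..n}. \<Sum>v\<in>{1..n}. (if v = Suc u then ?G u v else 0)) + (\<Sum>u\<in>{1..n}. \<Sum>v\<in>{1..n}. (if u = Suc v then ?G u v else 0))"
    unfolding sum.distrib[symmetric]
    by (intro sum.cong) (auto simp: path_weight_def path_edges_def path_verts_def)
  also have "(\<Sum>u\<in>{1..n}. \<Sum>v\<in>{1..n}. (if u = Suc v then ?G u v else 0))
      = (\<Sum>u\<in>{1..n}. \<Sum>v\<in>{1..n}. (if v = Suc u then ?G u v else 0))"
    by (subst sum.swap) (intro sum.cong refl, simp add: abs_minus_commute)
  also have "(\<Sum>u\<in>{1..n}. \<Sum>v\<in>{1..n}. (if v = Suc u then ?G u v else 0)) = (\<Sum>u\<in>{1..n}. if u < n then ?G u (Suc u) else 0)"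
    by (intro sum.cong) auto
  also have "\<dots> = path_energy p n g"
    unfolding path_energy_def by (intro sum.mono_neutral_cong_right) auto
  finally show ?thesis by (simp add: p_rayleigh_def path_verts_def)
qed

lemma path_energy_le:
  assumes "p > 1" "p_solution p lam F" "n \<ge> 1" "c n = 0"
    and edge: "\<And>u. u \<in> {1..<n} \<Longrightarrow> c u = c (Suc u) \<or> F u * F (Suc u) \<le> 0"
  shows "path_energy p n (\<lambda>u. c u * F u) \<le> lam * (\<Sum>u\<in>{1..n}. \<bar>c u * F u\<bar> powr p)"
  unfolding path_energy_def p_solution_energy[of p lam F n c, OF assms(1-4), symmetric]
proof (rule sum_mono)
  fix u assume "u \<in> {1..<n}"
  then show "\<bar>c u * F u - c (Suc u) * F (Suc u)\<bar> powr p
      \<le> p_power p (F u - F (Suc u)) * (\<bar>c u\<bar> powr p * F u - \<bar>c (Suc u)\<bar> powr p * F (Suc u))"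
    using edge edge_energy_le[OF assms(1)] edge_energy_eq[OF assms(1)] by (metis order_refl)
qed

lemma path_energy_ge:
  assumes "p > 1" "p_solution p lam F" "n \<ge> 1" "c n = 0"
    and edge: "\<And>u. u \<in> {1..<n} \<Longrightarrow> c u = c (Suc u) \<or> F u = 0 \<or> F (Suc u) = 0 \<or> F u * F (Suc u) > 0"
  shows "lam * (\<Sum>u\<in>{1..n}. \<bar>c u * F u\<bar> powr p) \<le> path_energy p n (\<lambda>u. c u * F u)"
  unfolding path_energy_def p_solution_energy[of p lam F n c, OF assms(1-4), symmetric]
proof (rule sum_mono)
  fix u assume "u \<in> {1..<n}"
  then show "p_power p (F u - F (Suc u)) * (\<bar>c u\<bar> powr p * F u - \<bar>c (Suc u)\<bar> powr p * F (Suc u))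
      \<le> \<bar>c u * F u - c (Suc u) * F (Suc u)\<bar> powr p"
    using edge edge_energy_ge[OF assms(1)] edge_energy_eq[OF assms(1)] by (metis order_refl)
qed

section \<open>Blocks of oscillating functions\<close>

text \<open>
  This keeps exactly those properties of an eigenfunction on which the nodal counts depend. They
  are inherited by nearby solutions of the recurrence.
\<close>

definition oscillating :: "nat \<Rightarrow> (nat \<Rightarrow> real) \<Rightarrow> bool" where
  "oscillating n f \<longleftrightarrow> n \<ge> 1 \<and> f 1 \<noteq> 0 \<and> f n \<noteq> 0 \<and>
     (\<forall>u. Suc u < n \<longrightarrow> f (Suc u) = 0 \<longrightarrow> f u * f (Suc (Suc u)) < 0)"

text \<open>
  A break \<open>j\<close> cuts the edge from \<open>j\<close> to \<open>j + 1\<close>. Asking for \<open>f j \<noteq> 0\<close> makes a sign change through a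
  zero count once, with the zero opening the new block.
\<close>

definition breaks :: "(nat \<Rightarrow> real) \<Rightarrow> nat \<Rightarrow> bool" where
  "breaks f j \<longleftrightarrow> f j \<noteq> 0 \<and> f j * f (Suc j) \<le> 0"

definition block :: "(nat \<Rightarrow> real) \<Rightarrow> nat \<Rightarrow> nat" where
  "block f u = card {j\<in>{1..<u}. breaks f j}"

lemma block_1 [simp]: "block f (Suc 0) = 0"
  by (simp add: block_def)

lemma block_Suc: "u \<ge> 1 \<Longrightarrow> block f (Suc u) = (if breaks f u then Suc (block f u) else block f u)"
proof -
  assume "u \<ge> 1"
  then have "{j\<in>{1..<Suc u}. breaks f j} =
      (if breaks f u then insert u {j\<in>{1..<u}. breaks f j} else {j\<in>{1..<u}. breaks f j})"
    by (auto simp: less_Suc_eq)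
  then show ?thesis by (simp add: block_def)
qed

lemma block_mono: "u \<le> v \<Longrightarrow> block f u \<le> block f v"
  unfolding block_def by (intro card_mono) auto

lemma block_less_after_break: "breaks f j \<Longrightarrow> 1 \<le> j \<Longrightarrow> j < u \<Longrightarrow> block f j < block f u"
  using block_Suc[of j f] block_mono[of "Suc j" u f] by simp

lemma exists_break_of_block:
  assumes "i < block f u" "u \<ge> 1"
  shows "\<exists>j\<in>{1..<u}. breaks f j \<and> block f j = i"
  using \<open>u \<ge> 1\<close> assms(1)
proof (induction u rule: dec_induct)
  case (step u)
  show ?case
  proof (cases "i < block f u")
    case True
    then show ?thesis using step.IH by force
  next
    case False
    then have "breaks f u" "block f u = i" using step by (auto simp: block_Suc split: if_splits)
    then show ?thesis using step by auto
  qed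
qed simp

lemma oscillating_zero_interior:
  assumes "oscillating n f" "u \<in> {1..n}" "f u = 0"
  obtains v where "u = Suc v" "1 \<le> v" "Suc u \<le> n" "f v * f (Suc u) < 0" "breaks f v"
    "block f u = Suc (block f v)" "block f (Suc u) = block f u"
proof -
  obtain v where v: "u = Suc v" using assms by (metis atLeastAtMost_iff not_one_le_zero nat.exhaust)
  have "v \<noteq> 0" "u \<noteq> n" using assms v by (auto simp: oscillating_def intro: Suc_leI gr0I)
  then have neg: "f v * f (Suc u) < 0" using assms v unfolding oscillating_def by auto
  then have "breaks f v" using assms v by (auto simp: breaks_def)
  moreover have "block f (Suc u) = block f u" using block_Suc[of u f] v assms(3) by (simp add: breaks_def)
  ultimately show thesis using that v \<open>v \<noteq> 0\<close> \<open>u \<noteq> n\<close> neg assms block_Suc[of v f] by simp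
qed

definition block_sign :: "(nat \<Rightarrow> real) \<Rightarrow> nat \<Rightarrow> real" where
  "block_sign f i = f 1 * (- 1) ^ i"

lemma block_sign_nonzero: "oscillating n f \<Longrightarrow> block_sign f i \<noteq> 0"
  by (simp add: block_sign_def oscillating_def)

lemma mult_pos_trans: "a * b > 0 \<Longrightarrow> b * c > 0 \<Longrightarrow> a * c > (0::real)"
  by (auto simp: zero_less_mult_iff)

lemma mult_neg_trans: "a * b > 0 \<Longrightarrow> b * c < 0 \<Longrightarrow> a * c < (0::real)"
  by (auto simp: zero_less_mult_iff mult_less_0_iff)

text \<open>
  The sign alternates from block to block. Hence the block index determines the sign on the block.
\<close>

lemma block_sign_mult_pos:
  assumes "oscillating n f" "u \<in> {1..n}" "f u \<noteq> 0"
  shows "block_sign f (block f u) * f u > 0"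
  using assms(2,3)
proof (induction u rule: less_induct)
  case (less u)
  consider "u = 1" | v where "u = Suc v" "v \<ge> 1" using less.prems by (cases u) force+
  then show ?case
  proof cases
    case 1
    then show ?thesis using assms(1) by (auto simp: block_sign_def oscillating_def zero_less_mult_iff neq_iff)
  next
    case 2
    have v: "v \<in> {1..n}" "v < u" using 2 less.prems by auto
    show ?thesis
    proof (cases "f v = 0")
      case False
      have IH: "block_sign f (block f v) * f v > 0" using less.IH v False by blast
      show ?thesis
      proof (cases "breaks f v")
        case True
        then have "f v * f u < 0" using less.prems(2) 2 False by (auto simp: breaks_def less_le)
        with IH have "block_sign f (block f v) * f u < 0" by (rule mult_neg_trans)
        then show ?thesis using True 2 by (simp add: block_Suc block_sign_def)
      next
        case nb: False
        then have "f v * f u > 0" using 2 False by (auto simp: breaks_def)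
        with IH have "block_sign f (block f v) * f u > 0" by (rule mult_pos_trans)
        then show ?thesis using nb 2 by (simp add: block_Suc)
      qed
    next
      case True
      obtain x where x: "v = Suc x" "1 \<le> x" "f x * f u < 0" "block f u = Suc (block f x)"
        using oscillating_zero_interior[OF assms(1) v(1) True] 2 by metis
      have "block_sign f (block f x) * f x > 0" using less.IH[of x] x v 2 by (auto simp: mult_less_0_iff)
      then have "block_sign f (block f x) * f u < 0" using x(3) by (rule mult_neg_trans)
      then show ?thesis using x by (simp add: block_sign_def)
    qed
  qed
qed

text \<open>
  Across a zero of \<open>f\<close> the two neighbours keep their opposite signs in \<open>g\<close>, whatever the value of
  \<open>g\<close> in between; so exactly one of the two edges is a break of \<open>g\<close>, as for \<open>f\<close>.
\<close>

lemma block_perturb: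
  assumes f: "oscillating n f" and g: "oscillating n g"
    and same: "\<And>u. u \<in> {1..n} \<Longrightarrow> f u \<noteq> 0 \<Longrightarrow> f u * g u > 0"
    and "u \<in> {1..n}" "f u \<noteq> 0"
  shows "block g u = block f u"
  using assms(4,5)
proof (induction u rule: less_induct)
  case (less u)
  consider "u = 1" | v where "u = Suc v" "v \<ge> 1" using less.prems by (cases u) force+
  then show ?case
  proof cases
    case 2
    have v: "v \<in> {1..n}" "v < u" using 2 less.prems by auto
    have su: "f u * g u > 0" using same less.prems by blast
    show ?thesis
    proof (cases "f v = 0")
      case False
      have "f v * g v > 0" using same v False by blast
      then have "breaks f v \<longleftrightarrow> breaks g v"
        using su 2 by (auto simp: breaks_def zero_less_mult_iff mult_le_0_iff)
      then show ?thesis using less.IH[OF v(2,1) False] 2 by (simp add: block_Suc)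
    next
      case True
      obtain x where x: "v = Suc x" "1 \<le> x" "f x * f u < 0" "block f u = Suc (block f x)"
        using oscillating_zero_interior[OF f v(1) True] 2 by metis
      have fx: "f x \<noteq> 0" "x \<in> {1..n}" "x < u" using x v 2 by auto
      have IH: "block g x = block f x" using less.IH[OF fx(3,2,1)] .
      have sx: "f x * g x > 0" using same fx by blast
      have neg: "g x * g u < 0" using sx su x(3) by (auto simp: zero_less_mult_iff mult_less_0_iff)
      then have "breaks g x \<longleftrightarrow> \<not> breaks g v"
        using x 2 by (auto simp: breaks_def mult_less_0_iff mult_le_0_iff)
      then show ?thesis using IH x 2 v by (auto simp: block_Suc)
    qed
  qed simp
qed

text \<open>
  Every zero opens a block other than the first, so block indices of zeros are distinct and positive.
\<close>

lemma card_zeros_le: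
  assumes "oscillating n f"
  shows "card {u\<in>{1..n}. f u = 0} \<le> block f n"
proof -
  let ?Z = "{u\<in>{1..n}. f u = 0}"
  have pos: "1 \<le> block f u" if "u \<in> ?Z" for u
  proof -
    have u: "u \<in> {1..n}" "f u = 0" using that by auto
    show ?thesis by (rule oscillating_zero_interior[OF assms u]) simp
  qed
  have less: "block f u < block f v" if uv: "v \<in> ?Z" "u \<in> ?Z" "u < v" for u v
  proof -
    have v: "v \<in> {1..n}" "f v = 0" using uv(1) by auto
    obtain w where "v = Suc w" "block f v = Suc (block f w)"
      using oscillating_zero_interior[OF assms v] by metis
    then show ?thesis using block_mono[of u w f] uv(3) by simp
  qed
  have "inj_on (block f) ?Z"
  proof (rule inj_onI)
    fix u v assume "u \<in> ?Z" "v \<in> ?Z" "block f u = block f v"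
    then show "u = v" using less[of u v] less[of v u] by (cases u v rule: linorder_cases) simp_all
  qed
  moreover have "block f ` ?Z \<subseteq> {1..block f n}" using pos block_mono[of _ n f] by auto
  ultimately show ?thesis using card_inj_on_le[of "block f" ?Z "{1..block f n}"] by simp
qed

section \<open>Connected sets of the path\<close>

text \<open>
  In a path, maximality of a connected set only has to be tested on the two neighbours of its ends.
\<close>

lemma interval_is_component:
  assumes "A \<subseteq> S" "S \<subseteq> {1..n}" "A \<noteq> {}"
    and convex: "\<And>u v w. u \<in> A \<Longrightarrow> v \<in> A \<Longrightarrow> u \<le> w \<Longrightarrow> w \<le> v \<Longrightarrow> w \<in> A"
    and up: "\<And>u. u \<in> A \<Longrightarrow> Suc u \<in> S \<Longrightarrow> Suc u \<in> A"
    and down: "\<And>u. Suc u \<in> A \<Longrightarrow> u \<in> S \<Longrightarrow> u \<in> A"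
  shows "graph_component (path_edges n) S A"
proof -
  let ?R = "path_edges n \<inter> A \<times> A"
  have le: "(u, v) \<in> ?R\<^sup>*" if "u \<le> v" "u \<in> A" "v \<in> A" for u v
    using that(1,3)
  proof (induction v rule: dec_induct)
    case (step v)
    have "v \<in> A" by (rule convex[OF \<open>u \<in> A\<close> step.prems]) (use step.hyps in auto)
    moreover have "{v, Suc v} \<subseteq> {1..n}" using calculation step.prems assms(1,2) by blast
    ultimately have "(v, Suc v) \<in> ?R" using step.prems by (simp add: path_edges_def path_verts_def)
    then show ?case by (rule rtrancl_into_rtrancl[OF step.IH[OF \<open>v \<in> A\<close>]])
  qed simp
  have "sym ?R" by (auto simp: sym_def path_edges_def)
  then have sym: "(u, v) \<in> ?R\<^sup>* \<Longrightarrow> (v, u) \<in> ?R\<^sup>*" for u v by (rule symD[OF sym_rtrancl])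
  have "(u, v) \<in> ?R\<^sup>*" if "u \<in> A" "v \<in> A" for u v
    using le[of u v] sym[OF le[of v u]] that by (cases "u \<le> v") auto
  then have "connected_in (path_edges n) A"
    unfolding connected_in_def using assms(3) by blast
  moreover have "B = A" if B: "A \<subseteq> B" "B \<subseteq> S" "connected_in (path_edges n) B" for B
  proof -
    obtain a where "a \<in> A" using assms(3) by blast
    have "v \<in> A" if "v \<in> B" for v
    proof -
      have "(a, v) \<in> (path_edges n \<inter> B \<times> B)\<^sup>*"
        using B(3) subsetD[OF B(1) \<open>a \<in> A\<close>] that by (simp add: connected_in_def)
      then show "v \<in> A"
      proof (induction rule: rtrancl_induct)
        case (step y z)
        then have z: "z \<in> S" "z = Suc y \<or> y = Suc z" using B(2) by (auto simp: path_edges_def)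
        from z(2) show ?case
        proof
          assume "z = Suc y"
          then show ?thesis using up[OF step.IH] z(1) by simp
        next
          assume "y = Suc z"
          then show ?thesis using down[of z] step.IH z(1) by simp
        qed
      qed (use \<open>a \<in> A\<close> in simp)
    qed
    then show ?thesis using B(1) by blast
  qed
  ultimately show ?thesis unfolding graph_component_def using assms(1) by blast
qed

lemma graph_component_unique:
  assumes A: "graph_component E S A" and B: "graph_component E S B" and "x \<in> A" "x \<in> B"
  shows "A = B"
proof -
  let ?C = "A \<union> B"
  have mono: "(E \<inter> A \<times> A)\<^sup>* \<subseteq> (E \<inter> ?C \<times> ?C)\<^sup>*" "(E \<inter> B \<times> B)\<^sup>* \<subseteq> (E \<inter> ?C \<times> ?C)\<^sup>*"
    by (intro rtrancl_mono; blast)+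
  have conn: "connected_in E A" "connected_in E B" using A B by (auto simp: graph_component_def)
  have x: "(u, x) \<in> (E \<inter> ?C \<times> ?C)\<^sup>* \<and> (x, u) \<in> (E \<inter> ?C \<times> ?C)\<^sup>*" if "u \<in> ?C" for u
    using that
  proof
    assume "u \<in> A"
    then have "(u, x) \<in> (E \<inter> A \<times> A)\<^sup>*" "(x, u) \<in> (E \<inter> A \<times> A)\<^sup>*"
      using conn(1) \<open>x \<in> A\<close> by (simp_all add: connected_in_def)
    then show ?thesis using mono(1) by blast
  next
    assume "u \<in> B"
    then have "(u, x) \<in> (E \<inter> B \<times> B)\<^sup>*" "(x, u) \<in> (E \<inter> B \<times> B)\<^sup>*"
      using conn(2) \<open>x \<in> B\<close> by (simp_all add: connected_in_def)
    then show ?thesis using mono(2) by blast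
  qed
  have "(u, v) \<in> (E \<inter> ?C \<times> ?C)\<^sup>*" if "u \<in> ?C" "v \<in> ?C" for u v
    by (rule rtrancl_trans[OF conjunct1[OF x[OF that(1)]] conjunct2[OF x[OF that(2)]]])
  then have "connected_in E ?C"
    unfolding connected_in_def using \<open>x \<in> A\<close> by blast
  moreover have "?C \<subseteq> S" using A B by (simp add: graph_component_def)
  ultimately have "?C = A" "?C = B"
    using A B unfolding graph_component_def by (meson sup_ge1 sup_ge2)+
  then show ?thesis by simp
qed

section \<open>Nodal counts\<close>

text \<open>
  Writing both kinds of half-spaces with a sign factor lets \<open>block_sign\<close> select the relevant one
  without a case distinction.
\<close>

lemma strong_nodal_domain_iff:
  "strong_nodal_domain V E f A \<longleftrightarrow> (\<exists>\<sigma>. \<sigma> \<noteq> 0 \<and> graph_component E {u\<in>V. \<sigma> * f u > 0} A)"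
proof
  assume "strong_nodal_domain V E f A"
  then have "graph_component E {u\<in>V. 1 * f u > 0} A \<or> graph_component E {u\<in>V. (-1) * f u > 0} A"
    by (simp add: strong_nodal_domain_def)
  then show "\<exists>\<sigma>. \<sigma> \<noteq> 0 \<and> graph_component E {u\<in>V. \<sigma> * f u > 0} A"
    by (metis zero_neq_neg_one zero_neq_one)
next
  assume "\<exists>\<sigma>. \<sigma> \<noteq> 0 \<and> graph_component E {u\<in>V. \<sigma> * f u > 0} A"
  then obtain \<sigma> where \<sigma>: "\<sigma> \<noteq> 0" "graph_component E {u\<in>V. \<sigma> * f u > 0} A" by blast
  have "{u\<in>V. \<sigma> * f u > 0} = (if \<sigma> > 0 then {u\<in>V. f u > 0} else {u\<in>V. f u < 0})"
    using \<sigma>(1) by (auto simp: zero_less_mult_iff)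
  then show "strong_nodal_domain V E f A"
    using \<sigma>(2) unfolding strong_nodal_domain_def by presburger
qed

lemma weak_nodal_domain_iff:
  "weak_nodal_domain V E f A \<longleftrightarrow> (\<exists>\<sigma>. \<sigma> \<noteq> 0 \<and> graph_component E {u\<in>V. \<sigma> * f u \<ge> 0} A)"
proof
  assume "weak_nodal_domain V E f A"
  then have "graph_component E {u\<in>V. 1 * f u \<ge> 0} A \<or> graph_component E {u\<in>V. (-1) * f u \<ge> 0} A"
    by (simp add: weak_nodal_domain_def)
  then show "\<exists>\<sigma>. \<sigma> \<noteq> 0 \<and> graph_component E {u\<in>V. \<sigma> * f u \<ge> 0} A"
    by (metis zero_neq_neg_one zero_neq_one)
next
  assume "\<exists>\<sigma>. \<sigma> \<noteq> 0 \<and> graph_component E {u\<in>V. \<sigma> * f u \<ge> 0} A"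
  then obtain \<sigma> where \<sigma>: "\<sigma> \<noteq> 0" "graph_component E {u\<in>V. \<sigma> * f u \<ge> 0} A" by blast
  have "{u\<in>V. \<sigma> * f u \<ge> 0} = (if \<sigma> > 0 then {u\<in>V. f u \<ge> 0} else {u\<in>V. f u \<le> 0})"
    using \<sigma>(1) by (auto simp: zero_le_mult_iff)
  then show "weak_nodal_domain V E f A"
    using \<sigma>(2) unfolding weak_nodal_domain_def by presburger
qed

lemma card_indexed_family:
  assumes "\<And>i. i \<le> m \<Longrightarrow> P (B i)" and "\<And>A. P A \<Longrightarrow> \<exists>i\<le>m. A = B i" and "inj_on B {..m}"
  shows "card {A. P A} = Suc m"
proof -
  have "{A. P A} = B ` {..m}" using assms by auto
  then show ?thesis using assms(3) by (simp add: card_image)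
qed

text \<open>
  The nodal domains attached to block \<open>i\<close>; the weak one also takes in the zero that opens the
  following block.
\<close>

definition strong_block :: "nat \<Rightarrow> (nat \<Rightarrow> real) \<Rightarrow> nat \<Rightarrow> nat set" where
  "strong_block n f i = {u\<in>{1..n}. block f u = i \<and> f u \<noteq> 0}"

definition weak_block :: "nat \<Rightarrow> (nat \<Rightarrow> real) \<Rightarrow> nat \<Rightarrow> nat set" where
  "weak_block n f i = {u\<in>{1..n}. block f u = i \<or> (f u = 0 \<and> block f u = Suc i)}"

lemma exists_strong_block:
  assumes "oscillating n f" "i \<le> block f n"
  shows "\<exists>u. u \<in> strong_block n f i"
proof (cases "i = block f n")
  case True
  then show ?thesis using assms by (auto simp: strong_block_def oscillating_def)
next
  case False
  then have "i < block f n" "n \<ge> 1" using assms by (auto simp: oscillating_def)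
  then obtain j where "j \<in> {1..<n}" "breaks f j" "block f j = i" using exists_break_of_block by blast
  then show ?thesis by (auto simp: strong_block_def breaks_def)
qed

lemma strong_block_component:
  assumes f: "oscillating n f" and "i \<le> block f n"
  shows "graph_component (path_edges n) {u\<in>{1..n}. block_sign f i * f u > 0} (strong_block n f i)"
proof (rule interval_is_component)
  let ?S = "{u\<in>{1..n}. block_sign f i * f u > 0}" and ?B = "strong_block n f i"
  show BS: "?B \<subseteq> ?S" using block_sign_mult_pos[OF f] by (auto simp: strong_block_def)
  show "?B \<noteq> {}" using exists_strong_block[OF assms] by blast
  show "w \<in> ?B" if "u \<in> ?B" "v \<in> ?B" "u \<le> w" "w \<le> v" for u v w
  proof -
    have w: "w \<in> {1..n}" "block f w = i"
      using that block_mono[of u w f] block_mono[of w v f] by (auto simp: strong_block_def)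
    have "f w \<noteq> 0"
    proof
      assume "f w = 0"
      then obtain x where "w = Suc x" "block f w = Suc (block f x)"
        using oscillating_zero_interior[OF f w(1)] by metis
      moreover have "u \<noteq> w" using that \<open>f w = 0\<close> by (auto simp: strong_block_def)
      ultimately have "block f u < block f w" using block_mono[of u x f] that by simp
      then show False using that w by (simp add: strong_block_def)
    qed
    then show ?thesis using w by (simp add: strong_block_def)
  qed
  have edge: "block f (Suc u) = block f u" if "u \<in> ?S" "Suc u \<in> ?S" for u
  proof -
    have "f u * f (Suc u) > 0" using that by (auto simp: zero_less_mult_iff)
    then show ?thesis using that by (auto simp: block_Suc breaks_def)
  qed
  show "Suc u \<in> ?B" if "u \<in> ?B" "Suc u \<in> ?S" for u
    using that edge[of u] BS by (auto simp: strong_block_def)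
  show "u \<in> ?B" if "Suc u \<in> ?B" "u \<in> ?S" for u
    using that edge[of u] BS by (auto simp: strong_block_def)
qed auto

text \<open>
  A vertex outside block \<open>i\<close> but next to it is the last vertex of the preceding block, where \<open>f\<close> has
  the opposite sign, or the first vertex of the following block, where \<open>f\<close> has the opposite sign or
  vanishes. Only a zero of the last kind has to be added, and its successor has the opposite sign.
\<close>

lemma weak_block_component:
  assumes f: "oscillating n f" and "i \<le> block f n"
  shows "graph_component (path_edges n) {u\<in>{1..n}. block_sign f i * f u \<ge> 0} (weak_block n f i)"
proof (rule interval_is_component)
  let ?S = "{u\<in>{1..n}. block_sign f i * f u \<ge> 0}" and ?B = "weak_block n f i"
  show "?B \<subseteq> ?S"
  proof
    fix u assume "u \<in> ?B"
    then show "u \<in> ?S" using block_sign_mult_pos[OF f, of u] by (cases "f u = 0") (auto simp: weak_block_def)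
  qed
  show "?B \<noteq> {}" using exists_strong_block[OF assms] by (auto simp: strong_block_def weak_block_def)
  show "w \<in> ?B" if uvw: "u \<in> ?B" "v \<in> ?B" "u \<le> w" "w \<le> v" for u v w
  proof (cases "w = v")
    case False
    have w: "w \<in> {1..n}" "i \<le> block f w" using uvw block_mono[of u w f] by (auto simp: weak_block_def)
    have "block f w \<le> i"
    proof (cases "block f v = i")
      case True
      then show ?thesis using block_mono[of w v f] uvw by simp
    next
      case nv: False
      then have "v \<in> {1..n}" "f v = 0" "block f v = Suc i" using uvw by (auto simp: weak_block_def)
      then obtain x where "v = Suc x" "block f v = Suc (block f x)"
        using oscillating_zero_interior[OF f] by metis
      then show ?thesis using block_mono[of w x f] uvw False \<open>block f v = Suc i\<close> by simp
    qed
    then show ?thesis using w by (simp add: weak_block_def)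
  qed (use uvw in simp)
  have neg: "f u = 0" if "u \<in> ?S" "block f u = Suc i \<or> Suc (block f u) = i" for u
  proof (rule ccontr)
    assume "f u \<noteq> 0"
    then have "block_sign f (block f u) * f u > 0" using block_sign_mult_pos[OF f] that by blast
    moreover have "block_sign f (block f u) = - block_sign f i"
      using that(2) by (auto simp: block_sign_def)
    ultimately show False using that(1) by simp
  qed
  have zero_next: "f (Suc u) \<noteq> 0 \<and> block f (Suc u) = block f u" if "u \<in> {1..n}" "f u = 0" for u
    by (rule oscillating_zero_interior[OF f that]) (auto simp: mult_less_0_iff)
  have zero_prev: "f u \<noteq> 0 \<and> block f (Suc u) = Suc (block f u)" if "Suc u \<in> {1..n}" "f (Suc u) = 0" for u
    by (rule oscillating_zero_interior[OF f that]) (auto simp: breaks_def)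
  have same: "block f (Suc u) = block f u" if "u \<in> ?S" "Suc u \<in> ?S" "f u \<noteq> 0" "f (Suc u) \<noteq> 0" for u
  proof -
    have "f u * f (Suc u) > 0"
      using that block_sign_nonzero[OF f, of i] by (auto simp: zero_less_mult_iff zero_le_mult_iff)
    then show ?thesis using that by (auto simp: block_Suc breaks_def)
  qed
  show "Suc u \<in> ?B" if "u \<in> ?B" "Suc u \<in> ?S" for u
  proof -
    have u: "u \<in> ?S" using that(1) \<open>?B \<subseteq> ?S\<close> by (rule subsetD[rotated])
    then have un: "u \<in> {1..n}" by simp
    show ?thesis
    proof (cases "f u = 0")
      case True
      then have "f (Suc u) \<noteq> 0" "block f (Suc u) = block f u" using zero_next[OF un] by auto
      moreover have "block f u = i \<or> block f u = Suc i" using that(1) by (auto simp: weak_block_def)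
      ultimately show ?thesis using neg[OF that(2)] that(2) by (auto simp: weak_block_def)
    next
      case False
      then have i: "block f u = i" using that(1) by (simp add: weak_block_def)
      show ?thesis
      proof (cases "f (Suc u) = 0")
        case True
        then show ?thesis using zero_prev[of u] that(2) i by (simp add: weak_block_def)
      next
        case nz: False
        then show ?thesis using same[OF u that(2) False nz] that(2) i by (simp add: weak_block_def)
      qed
    qed
  qed
  show "u \<in> ?B" if "Suc u \<in> ?B" "u \<in> ?S" for u
  proof -
    have u: "Suc u \<in> ?S" using that(1) \<open>?B \<subseteq> ?S\<close> by (rule subsetD[rotated])
    then have un: "Suc u \<in> {1..n}" "u \<in> {1..n}" using that(2) by auto
    show ?thesis
    proof (cases "f (Suc u) = 0")
      case True
      then have "f u \<noteq> 0" "block f (Suc u) = Suc (block f u)" using zero_prev[OF un(1)] by auto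
      moreover have "block f (Suc u) = i \<or> block f (Suc u) = Suc i" using that(1) by (auto simp: weak_block_def)
      ultimately show ?thesis using neg[OF that(2)] un(2) by (auto simp: weak_block_def)
    next
      case False
      then have i: "block f (Suc u) = i" using that(1) by (simp add: weak_block_def)
      show ?thesis
      proof (cases "f u = 0")
        case True
        then show ?thesis using zero_next[OF un(2)] un(2) i by (simp add: weak_block_def)
      next
        case nz: False
        then show ?thesis using same[OF that(2) u nz False] un(2) i by (simp add: weak_block_def)
      qed
    qed
  qed
qed auto

lemma card_strong_nodal_domains:
  assumes f: "oscillating n f"
  shows "card {A. strong_nodal_domain (path_verts n) (path_edges n) f A} = Suc (block f n)"
proof (rule card_indexed_family)
  show "strong_nodal_domain (path_verts n) (path_edges n) f (strong_block n f i)" if "i \<le> block f n" for i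
    unfolding strong_nodal_domain_iff path_verts_def
    using strong_block_component[OF f that] block_sign_nonzero[OF f] by blast
  show "inj_on (strong_block n f) {..block f n}"
  proof (rule inj_onI)
    fix i j assume "i \<in> {..block f n}" "strong_block n f i = strong_block n f j"
    then obtain u where "u \<in> strong_block n f i" "u \<in> strong_block n f j"
      using exists_strong_block[OF f] by blast
    then show "i = j" by (simp add: strong_block_def)
  qed
  fix A assume "strong_nodal_domain (path_verts n) (path_edges n) f A"
  then obtain \<sigma> where \<sigma>: "\<sigma> \<noteq> 0" "graph_component (path_edges n) {u\<in>{1..n}. \<sigma> * f u > 0} A"
    unfolding strong_nodal_domain_iff path_verts_def by blast
  then have "A \<subseteq> {u\<in>{1..n}. \<sigma> * f u > 0}" "A \<noteq> {}" by (auto simp: graph_component_def connected_in_def)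
  then obtain u where u: "u \<in> A" "u \<in> {1..n}" "\<sigma> * f u > 0" by blast
  then have "f u \<noteq> 0" by auto
  define i where "i = block f u"
  have i: "i \<le> block f n" "u \<in> strong_block n f i" "block_sign f i * f u > 0"
    using u \<open>f u \<noteq> 0\<close> block_mono[of u n f] block_sign_mult_pos[OF f u(2)] by (simp_all add: strong_block_def i_def)
  have "{u\<in>{1..n}. \<sigma> * f u > 0} = {u\<in>{1..n}. block_sign f i * f u > 0}"
    using u(3) i(3) by (auto simp: zero_less_mult_iff)
  then have "A = strong_block n f i"
    using graph_component_unique[OF \<sigma>(2) _ u(1) i(2)] strong_block_component[OF f i(1)] by simp
  then show "\<exists>i\<le>block f n. A = strong_block n f i" using i by blast
qed

text \<open>
  A zero belongs to two weak blocks, which have opposite signs; the sign of the half-space in which a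
  weak nodal domain lies decides which of them it is.
\<close>

lemma card_weak_nodal_domains:
  assumes f: "oscillating n f"
  shows "card {A. weak_nodal_domain (path_verts n) (path_edges n) f A} = Suc (block f n)"
proof (rule card_indexed_family)
  show "weak_nodal_domain (path_verts n) (path_edges n) f (weak_block n f i)" if "i \<le> block f n" for i
    unfolding weak_nodal_domain_iff path_verts_def
    using weak_block_component[OF f that] block_sign_nonzero[OF f] by blast
  show "inj_on (weak_block n f) {..block f n}"
  proof (rule inj_onI)
    fix i j assume ij: "i \<in> {..block f n}" "weak_block n f i = weak_block n f j"
    then obtain u where "u \<in> strong_block n f i" using exists_strong_block[OF f] by blast
    then have "f u \<noteq> 0" "block f u = i" "u \<in> weak_block n f i" by (auto simp: strong_block_def weak_block_def)
    moreover have "u \<in> weak_block n f j" using ij(2) calculation by simp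
    ultimately show "i = j" by (simp add: weak_block_def)
  qed
  fix A assume "weak_nodal_domain (path_verts n) (path_edges n) f A"
  then obtain \<sigma> where \<sigma>: "\<sigma> \<noteq> 0" "graph_component (path_edges n) {u\<in>{1..n}. \<sigma> * f u \<ge> 0} A"
    unfolding weak_nodal_domain_iff path_verts_def by blast
  then have "A \<subseteq> {u\<in>{1..n}. \<sigma> * f u \<ge> 0}" "A \<noteq> {}" by (auto simp: graph_component_def connected_in_def)
  then obtain u where u: "u \<in> A" "u \<in> {1..n}" "\<sigma> * f u \<ge> 0" by blast
  have "\<exists>i. i \<le> block f n \<and> u \<in> weak_block n f i \<and> block_sign f i * \<sigma> > 0"
  proof (cases "f u = 0")
    case False
    then have "block_sign f (block f u) * f u > 0" using block_sign_mult_pos[OF f u(2)] by blast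
    then have "block_sign f (block f u) * \<sigma> > 0"
      using False u(3) \<sigma>(1) by (auto simp: zero_less_mult_iff zero_le_mult_iff)
    then show ?thesis using u block_mono[of u n f] by (auto simp: weak_block_def)
  next
    case True
    obtain v where v: "block f u = Suc (block f v)" using oscillating_zero_interior[OF f u(2) True] by metis
    have "block_sign f (block f v) = - block_sign f (block f u)" using v by (simp add: block_sign_def)
    then have "block_sign f (block f u) * \<sigma> > 0 \<or> block_sign f (block f v) * \<sigma> > 0"
      using block_sign_nonzero[OF f, of "block f u"] \<sigma>(1)
      by (cases "block_sign f (block f u) * \<sigma>" "0::real" rule: linorder_cases) auto
    moreover have "block f u \<le> block f n" using u block_mono by simp
    moreover have "u \<in> weak_block n f (block f u)" "u \<in> weak_block n f (block f v)" "block f v \<le> block f u"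
      using v u True by (auto simp: weak_block_def)
    ultimately show ?thesis using le_trans by blast
  qed
  then obtain i where i: "i \<le> block f n" "u \<in> weak_block n f i" "block_sign f i * \<sigma> > 0" by blast
  have "{u\<in>{1..n}. \<sigma> * f u \<ge> 0} = {u\<in>{1..n}. block_sign f i * f u \<ge> 0}"
    using i(3) by (auto simp: zero_less_mult_iff zero_le_mult_iff)
  then have "A = weak_block n f i"
    using graph_component_unique[OF \<sigma>(2) _ u(1) i(2)] weak_block_component[OF f i(1)] by simp
  then show "\<exists>i\<le>block f n. A = weak_block n f i" using i by blast
qed

section \<open>Comparison with variational eigenvalues\<close>

lemma genus_le:
  assumes "odd_map_to_punctured A m h"
  shows "genus A \<le> enat m"
  using assms by (auto simp: genus_def intro!: Inf_lower)

lemma p_rayleigh_on_sphere: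
  "g \<in> p_sphere (path_verts n) p \<Longrightarrow> p_rayleigh (path_verts n) (path_weight n) p g = path_energy p n g"
  unfolding p_rayleigh_path by (simp add: p_sphere_def path_verts_def)

lemma path_energy_nonneg: "0 \<le> path_energy p n g"
  by (simp add: path_energy_def sum_nonneg)

lemma path_energy_bound:
  assumes "p > 1" "g \<in> p_sphere (path_verts n) p"
  shows "path_energy p n g \<le> real n * 2 powr p"
proof -
  have le1: "\<bar>g u\<bar> \<le> 1" for u
  proof (cases "u \<in> path_verts n")
    case True
    then have "\<bar>g u\<bar> powr p \<le> (\<Sum>v\<in>path_verts n. \<bar>g v\<bar> powr p)"
      by (intro member_le_sum) (auto simp: path_verts_def)
    also have "\<dots> = 1" using assms by (simp add: p_sphere_def)
    finally show ?thesis using assms(1) gr_one_powr[of "\<bar>g u\<bar>" p] by linarith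
  qed (use assms in \<open>simp add: p_sphere_def\<close>)
  have "\<bar>g u - g (Suc u)\<bar> \<le> 2" for u using le1[of u] le1[of "Suc u"] by linarith
  then have "path_energy p n g \<le> (\<Sum>u\<in>{1..<n}. 2 powr p)"
    unfolding path_energy_def using assms(1) by (intro sum_mono powr_mono2) auto
  also have "\<dots> \<le> real n * 2 powr p" by simp
  finally show ?thesis .
qed

lemma bdd_above_p_rayleigh:
  assumes "p > 1" "A \<subseteq> p_sphere (path_verts n) p"
  shows "bdd_above (p_rayleigh (path_verts n) (path_weight n) p ` A)"
proof (rule bdd_aboveI2)
  show "p_rayleigh (path_verts n) (path_weight n) p g \<le> real n * 2 powr p" if "g \<in> A" for g
    using path_energy_bound[OF assms(1)] that assms(2) by (auto simp: p_rayleigh_on_sphere)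
qed

lemma genus_family_nonempty_member:
  assumes "A \<in> genus_family V p k" "k \<ge> 1"
  shows "A \<noteq> {}"
  using assms by (auto simp: genus_family_def genus_def zero_enat_def)

lemma variational_eigenvalue_le:
  assumes "p > 1" "k \<ge> 1" and A: "A \<in> genus_family (path_verts n) p k"
    and le: "\<And>g. g \<in> A \<Longrightarrow> path_energy p n g \<le> lam"
  shows "variational_eigenvalue (path_verts n) (path_weight n) p k \<le> lam"
proof -
  let ?R = "p_rayleigh (path_verts n) (path_weight n) p"
  have sub: "B \<subseteq> p_sphere (path_verts n) p" if "B \<in> genus_family (path_verts n) p k" for B
    using that by (simp add: genus_family_def)
  have "0 \<le> (SUP g\<in>B. ?R g)" if B: "B \<in> genus_family (path_verts n) p k" for B
  proof -
    obtain g where g: "g \<in> B" using genus_family_nonempty_member[OF B assms(2)] by blast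
    then have "0 \<le> ?R g" using sub[OF B] path_energy_nonneg by (auto simp: p_rayleigh_on_sphere)
    also have "\<dots> \<le> (SUP g\<in>B. ?R g)" by (rule cSUP_upper[OF g bdd_above_p_rayleigh[OF assms(1) sub[OF B]]])
    finally show ?thesis .
  qed
  then have "bdd_below ((\<lambda>B. SUP g\<in>B. ?R g) ` genus_family (path_verts n) p k)" by (rule bdd_belowI2)
  then have "variational_eigenvalue (path_verts n) (path_weight n) p k \<le> (SUP g\<in>A. ?R g)"
    unfolding variational_eigenvalue_def by (rule cINF_lower[OF _ A])
  also have "\<dots> \<le> lam"
  proof (rule cSUP_least[OF genus_family_nonempty_member[OF A assms(2)]])
    show "?R g \<le> lam" if "g \<in> A" for g using le[OF that] that sub[OF A] by (auto simp: p_rayleigh_on_sphere)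
  qed
  finally show ?thesis .
qed

text \<open>
  The bound \<open>k \<le> n\<close> guarantees that the family over which the infimum is taken is not empty: the
  functions supported on the first \<open>k\<close> vertices provide a member.
\<close>

lemma variational_eigenvalue_ge:
  assumes "p > 1" "k \<ge> 1" "k \<le> n"
    and ge: "\<And>A. A \<in> genus_family (path_verts n) p k \<Longrightarrow> \<exists>g\<in>A. lam \<le> path_energy p n g"
  shows "lam \<le> variational_eigenvalue (path_verts n) (path_weight n) p k"
  unfolding variational_eigenvalue_def
proof (rule cINF_greatest)
  have "p_sphere (path_verts n) p \<inter> range (block_fun (path_verts n) k (\<lambda>u. u - 1) (\<lambda>u. 1)) \<in> genus_family (path_verts n) p k"
  proof (rule block_span_mem_genus_family)
    show "\<exists>u\<in>path_verts n. u - 1 = i \<and> (1::real) \<noteq> 0" if "i < k" for i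
      using that assms by (intro bexI[of _ "Suc i"]) (auto simp: path_verts_def)
  qed (use assms in \<open>auto simp: path_verts_def\<close>)
  then show "genus_family (path_verts n) p k \<noteq> {}" by blast
  fix A assume A: "A \<in> genus_family (path_verts n) p k"
  then have sub: "A \<subseteq> p_sphere (path_verts n) p" by (simp add: genus_family_def)
  obtain g where g: "g \<in> A" "lam \<le> path_energy p n g" using ge[OF A] by blast
  then have "lam \<le> p_rayleigh (path_verts n) (path_weight n) p g" using sub by (auto simp: p_rayleigh_on_sphere)
  also have "\<dots> \<le> (SUP g\<in>A. p_rayleigh (path_verts n) (path_weight n) p g)"
    by (rule cSUP_upper[OF g(1) bdd_above_p_rayleigh[OF assms(1) sub]])
  finally show "lam \<le> (SUP g\<in>A. p_rayleigh (path_verts n) (path_weight n) p g)" .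
qed

lemma oscillating_p_solution:
  assumes "p > 1" "p_solution p lam F" "n \<ge> 1" "F 1 \<noteq> 0" "F n \<noteq> 0"
  shows "oscillating n F"
  unfolding oscillating_def using assms p_solution_zero[OF assms(1,2,4)] by blast

text \<open>
  Put \<open>c = g / F\<close>. The break conditions make \<open>c\<close> agree on both sides of a sign change and force \<open>g\<close>
  to vanish at the zeros of \<open>F\<close>, so every edge satisfies the hypothesis of \<open>path_energy_ge\<close>.
\<close>

lemma path_energy_ge_of_break_conditions:
  assumes "p > 1" "p_solution p lam F" and F: "oscillating n F" and gn: "g n = 0"
    and brk: "\<And>u. u \<in> {1..<n} \<Longrightarrow> breaks F u \<Longrightarrow> g u * F (Suc u) = g (Suc u) * F u"
  shows "lam * (\<Sum>u\<in>{1..n}. \<bar>g u\<bar> powr p) \<le> path_energy p n g"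
proof -
  have n: "n \<ge> 1" using F by (simp add: oscillating_def)
  define c where "c u = (if F u = 0 then 0 else g u / F u)" for u
  have g0: "g u = 0" if u: "u \<in> {1..n}" "F u = 0" for u
  proof -
    obtain v where v: "u = Suc v" "1 \<le> v" "breaks F v"
      using oscillating_zero_interior[OF F u] by metis
    then have "g v * F u = g u * F v" using brk[of v] u by simp
    then show ?thesis using u v by (simp add: breaks_def)
  qed
  then have gc: "c u * F u = g u" if "u \<in> {1..n}" for u using that by (simp add: c_def)
  have "lam * (\<Sum>u\<in>{1..n}. \<bar>c u * F u\<bar> powr p) \<le> path_energy p n (\<lambda>u. c u * F u)"
  proof (rule path_energy_ge[OF assms(1,2) n])
    show "c n = 0" using gn by (simp add: c_def)
    show "c u = c (Suc u) \<or> F u = 0 \<or> F (Suc u) = 0 \<or> F u * F (Suc u) > 0" if "u \<in> {1..<n}" for u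
    proof (cases "breaks F u")
      case True
      then show ?thesis using brk[OF that] by (auto simp: c_def field_simps)
    qed (auto simp: breaks_def)
  qed
  moreover have "path_energy p n (\<lambda>u. c u * F u) = path_energy p n g"
    unfolding path_energy_def using gc by (intro sum.cong) auto
  moreover have "(\<Sum>u\<in>{1..n}. \<bar>c u * F u\<bar> powr p) = (\<Sum>u\<in>{1..n}. \<bar>g u\<bar> powr p)"
    using gc by (intro sum.cong) auto
  ultimately show ?thesis by simp
qed

text \<open>
  The break conditions and the condition at the last vertex are linear in \<open>g\<close> and number
  \<open>Suc (block F n)\<close>. Without a common zero in \<open>A\<close> they would be an odd map showing that the genus of
  \<open>A\<close> is below \<open>k\<close>.
\<close>

lemma exists_large_energy:
  assumes "p > 1" "p_solution p lam F" and F: "oscillating n F"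
    and A: "A \<in> genus_family (path_verts n) p k" and less: "Suc (block F n) < k"
  shows "\<exists>g\<in>A. lam \<le> path_energy p n g"
proof -
  let ?m = "Suc (block F n)"
  \<comment> \<open>the sum has a single term, since each block except the last ends in exactly one break\<close>
  define \<phi> where "\<phi> g i = (if i = block F n then g n else
      (\<Sum>j\<in>{j\<in>{1..<n}. breaks F j \<and> block F j = i}. g j * F (Suc j) - g (Suc j) * F j))" for g :: "nat \<Rightarrow> real" and i
  define h where "h g i = (if i < ?m then \<phi> g i else 0)" for g i
  have "\<not> odd_map_to_punctured A ?m h"
    using genus_le[of A ?m h] A less
    by (auto simp: genus_family_def) (metis enat_ord_simps(1) not_less_eq_eq less_imp_le_nat order_trans Suc_leI)
  moreover have "continuous_map (top_of_set A) (Euclidean_space ?m) h"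
    unfolding h_def continuous_map_componentwise_Euclidean_space
  proof (intro allI impI)
    fix i
    have "continuous_on A (\<lambda>g. g j)" for j :: nat
      by (rule continuous_on_subset[OF continuous_on_product_coordinates]) simp
    then have "continuous_on A (\<lambda>g. \<phi> g i)"
      unfolding \<phi>_def by (cases "i = block F n") (auto intro!: continuous_intros)
    then show "continuous_map (top_of_set A) euclideanreal (\<lambda>g. \<phi> g i)" by simp
  qed
  moreover have "h (\<lambda>v. - g v) = (\<lambda>i. - h g i)" for g
    by (auto simp: h_def \<phi>_def fun_eq_iff simp flip: sum_negf intro!: sum.cong)
  ultimately obtain g where g: "g \<in> A" "h g = (\<lambda>i. 0)" by (auto simp: odd_map_to_punctured_def)
  have \<phi>0: "\<phi> g i = 0" if "i \<le> block F n" for i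
    using fun_cong[OF g(2), of i] that by (simp add: h_def)
  have "g n = 0" using \<phi>0[of "block F n"] by (simp add: \<phi>_def)
  moreover have "g u * F (Suc u) = g (Suc u) * F u" if u: "u \<in> {1..<n}" "breaks F u" for u
  proof -
    have lt: "block F u < block F n" using block_less_after_break[OF u(2), of n] u(1) by simp
    have "{j\<in>{1..<n}. breaks F j \<and> block F j = block F u} = {u}"
    proof (intro equalityI subsetI)
      fix j assume j: "j \<in> {j\<in>{1..<n}. breaks F j \<and> block F j = block F u}"
      then show "j \<in> {u}"
        using block_less_after_break[OF u(2), of j] block_less_after_break[of F j u] u
        by (cases j u rule: linorder_cases) auto
    qed (use u in auto)
    then show ?thesis using \<phi>0[of "block F u"] lt by (simp add: \<phi>_def)
  qed
  ultimately have "lam * (\<Sum>u\<in>{1..n}. \<bar>g u\<bar> powr p) \<le> path_energy p n g"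
    by (rule path_energy_ge_of_break_conditions[OF assms(1-3)])
  moreover have "(\<Sum>u\<in>{1..n}. \<bar>g u\<bar> powr p) = 1"
    using A g(1) by (auto simp: genus_family_def p_sphere_def path_verts_def)
  ultimately show ?thesis using g(1) by auto
qed

text \<open>
  The span of the restrictions of \<open>F\<close> to its first \<open>k\<close> blocks. The last vertex lies in a later
  block, so all these functions vanish there.
\<close>

lemma variational_eigenvalue_le_of_many_blocks:
  assumes "p > 1" "p_solution p lam F" and F: "oscillating n F" and "1 \<le> k" "k \<le> block F n"
  shows "variational_eigenvalue (path_verts n) (path_weight n) p k \<le> lam"
proof (rule variational_eigenvalue_le[OF assms(1,4)])
  let ?A = "p_sphere (path_verts n) p \<inter> range (block_fun (path_verts n) k (block F) F)"
  have n: "n \<ge> 1" using F by (simp add: oscillating_def)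
  show "?A \<in> genus_family (path_verts n) p k"
  proof (rule block_span_mem_genus_family)
    show "\<exists>u\<in>path_verts n. block F u = i \<and> F u \<noteq> 0" if "i < k" for i
      using exists_strong_block[OF F, of i] that assms(5) by (auto simp: strong_block_def path_verts_def)
  qed (use assms in \<open>auto simp: path_verts_def\<close>)
  fix g assume g: "g \<in> ?A"
  then obtain c where c: "g = block_fun (path_verts n) k (block F) F c" by blast
  define b where "b u = (if block F u < k then c (block F u) else 0)" for u
  have gb: "b u * F u = g u" if "u \<in> {1..n}" for u
    using that by (simp add: c block_fun_def b_def path_verts_def)
  have "path_energy p n (\<lambda>u. b u * F u) \<le> lam * (\<Sum>u\<in>{1..n}. \<bar>b u * F u\<bar> powr p)"
  proof (rule path_energy_le[OF assms(1,2) n])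
    show "b n = 0" using assms(5) by (simp add: b_def)
    show "b u = b (Suc u) \<or> F u * F (Suc u) \<le> 0" if "u \<in> {1..<n}" for u
      using that by (cases "breaks F u") (auto simp: b_def block_Suc breaks_def)
  qed
  moreover have "path_energy p n (\<lambda>u. b u * F u) = path_energy p n g"
    unfolding path_energy_def using gb by (intro sum.cong) auto
  moreover have "(\<Sum>u\<in>{1..n}. \<bar>b u * F u\<bar> powr p) = 1"
    using g gb by (simp add: p_sphere_def path_verts_def)
  ultimately show "path_energy p n g \<le> lam" by simp
qed

lemma shoot_perturb:
  assumes "p > 1"
  obtains d where "d > 0"
    and "\<And>mu u. \<bar>mu - lam\<bar> < d \<Longrightarrow> u \<in> {1..n} \<Longrightarrow> shoot p a lam u \<noteq> 0 \<Longrightarrow> shoot p a lam u * shoot p a mu u > 0"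
proof -
  have "\<forall>\<^sub>F mu in nhds lam. shoot p a lam u \<noteq> 0 \<longrightarrow> shoot p a lam u * shoot p a mu u > 0" for u
  proof (cases "shoot p a lam u = 0")
    case False
    have "continuous_on UNIV (\<lambda>mu. shoot p a lam u * shoot p a mu u)"
      by (intro continuous_intros continuous_on_shoot assms)
    then have "((\<lambda>mu. shoot p a lam u * shoot p a mu u) \<longlongrightarrow> shoot p a lam u * shoot p a lam u) (nhds lam)"
      by (metis continuous_on_eq_continuous_at open_UNIV UNIV_I isCont_def tendsto_at_iff_tendsto_nhds)
    moreover have "shoot p a lam u * shoot p a lam u > 0" using False not_real_square_gt_zero by blast
    ultimately have "\<forall>\<^sub>F mu in nhds lam. shoot p a lam u * shoot p a mu u > 0" by (rule order_tendstoD(1))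
    then show ?thesis by (rule eventually_mono) simp
  qed simp
  then have "\<forall>\<^sub>F mu in nhds lam. \<forall>u\<in>{1..n}. shoot p a lam u \<noteq> 0 \<longrightarrow> shoot p a lam u * shoot p a mu u > 0"
    by (intro eventually_ball_finite) auto
  then obtain d where "d > 0" "\<And>mu. dist mu lam < d \<Longrightarrow> \<forall>u\<in>{1..n}. shoot p a lam u \<noteq> 0 \<longrightarrow> shoot p a lam u * shoot p a mu u > 0"
    unfolding eventually_nhds_metric by blast
  then show thesis using that by (auto simp: dist_real_def)
qed

theorem theorem3p13:
  fixes p :: real and n k :: nat and f :: "nat \<Rightarrow> real"
  assumes "p > 1" and "n \<ge> 1" and "1 \<le> k" and "k \<le> n"
    and "p_eigenfunction (path_verts n) (path_weight n) p
           (variational_eigenvalue (path_verts n) (path_weight n) p k) f"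
  shows "card {u \<in> path_verts n. f u = 0} \<le> k - 1 \<and>
    card {A. weak_nodal_domain (path_verts n) (path_edges n) f A} = k \<and>
    card {A. strong_nodal_domain (path_verts n) (path_edges n) f A} = k"
proof -
  define lam where "lam = variational_eigenvalue (path_verts n) (path_weight n) p k"
  define F where "F = shoot p (f 1)"
  have sol: "p_solution p mu (F mu)" for mu
    unfolding F_def by (rule p_solution_shoot[OF assms(1)])
  note ef = p_eigenfunction_path_solution[OF assms(1,2,5), folded lam_def F_def]
  have F1: "F mu 1 = f 1" for mu by (simp add: F_def)
  have "F lam n = f n" using ef(1)[of n] assms(2) by simp
  then have osc: "oscillating n (F lam)"
    using oscillating_p_solution[OF assms(1) sol assms(2)] F1 ef(2,3) by simp
  have oscf: "oscillating n f"
    unfolding oscillating_def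
  proof (intro conjI allI impI)
    fix u assume u: "Suc u < n" "f (Suc u) = 0"
    then have "u \<ge> 1" using ef(2) by (cases u) auto
    then have "f u = F lam u" "f (Suc u) = F lam (Suc u)" "f (Suc (Suc u)) = F lam (Suc (Suc u))"
      using ef(1) u(1) by auto
    then show "f u * f (Suc (Suc u)) < 0" using osc u unfolding oscillating_def by auto
  qed (use assms(2) ef(2,3) in auto)
  have blk_F: "block (F lam) n = block f n"
    using ef(1,3) assms(2) by (intro block_perturb[OF oscf osc]) (auto simp: zero_less_mult_iff neq_iff)
  obtain d where d: "d > 0"
    "\<And>mu u. \<bar>mu - lam\<bar> < d \<Longrightarrow> u \<in> {1..n} \<Longrightarrow> F lam u \<noteq> 0 \<Longrightarrow> F lam u * F mu u > 0"
    using shoot_perturb[OF assms(1)] unfolding F_def by blast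
  have near: "oscillating n (F mu) \<and> block (F mu) n = block f n" if mu: "\<bar>mu - lam\<bar> < d" for mu
  proof -
    have Fn: "F lam n \<noteq> 0" using osc by (simp add: oscillating_def)
    then have "F mu n \<noteq> 0" using d(2)[OF mu, of n] assms(2) by auto
    then have "oscillating n (F mu)" using oscillating_p_solution[OF assms(1) sol assms(2)] F1 ef(2) by simp
    moreover have "block (F mu) n = block (F lam) n"
      by (rule block_perturb[OF osc \<open>oscillating n (F mu)\<close> d(2)[OF mu]]) (use Fn assms(2) in auto)
    ultimately show ?thesis using blk_F by simp
  qed
  have "\<not> Suc (block f n) < k"
  proof
    assume less: "Suc (block f n) < k"
    \<comment> \<open>a larger parameter with the same blocks forces \<open>lam\<close> above itself\<close>
    let ?mu = "lam + d / 2"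
    have mu: "\<bar>?mu - lam\<bar> < d" using d(1) by simp
    have "?mu \<le> lam"
      unfolding lam_def[symmetric]
      using variational_eigenvalue_ge[OF assms(1,3,4)] exists_large_energy[OF assms(1) sol] near[OF mu] less
      unfolding lam_def by metis
    then show False using d(1) by simp
  qed
  moreover have "\<not> k \<le> block f n"
  proof
    assume le: "k \<le> block f n"
    \<comment> \<open>a smaller parameter with the same blocks forces \<open>lam\<close> below itself\<close>
    let ?mu = "lam - d / 2"
    have mu: "\<bar>?mu - lam\<bar> < d" using d(1) by simp
    have "lam \<le> ?mu"
      using variational_eigenvalue_le_of_many_blocks[OF assms(1) sol _ assms(3), of n ?mu] near[OF mu] le
      by (simp add: lam_def)
    then show False using d(1) by simp
  qed
  ultimately have "Suc (block f n) = k" by simp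
  then show ?thesis
    using card_zeros_le[OF oscf] card_weak_nodal_domains[OF oscf] card_strong_nodal_domains[OF oscf]
    unfolding path_verts_def by simp
qed

end
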